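(* Let $T\in\mathcal B(\mathcal H)$ and $a,c\in(0,\infty)$. Suppose $E\in\mathcal B(\mathcal H)$ is an idempotent such that $\|TE\|\le a$ and $c\|\xi\|\le\|T(I-E)\xi\|$ for every $\xi\in(I-E)\mathcal H$. Let $F=I-\mathcal R(T(I-E))$. Then (1) $\|T^*F\|\le a$; (2) $c\|\beta\|\le\|T^*(I-F)\beta\|$ for every $\beta\in(I-F)\mathcal H$. Moreover, if $E$ is the spectral projection of $|T|$ associated with $[0,c]$, then $F$ is the spectral projection of $|T^*|$ associated with $[0,c]$, and $I-E=\mathcal R(T^*(I-F))$.
   Context: For $S\in\mathcal B(\mathcal H)$, $\mathcal R(S)$ denotes the orthogonal projection onto the closure of the range of $S$. *)

theory Defs
  imports "HOL-Analysis.Analysis"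
begin

class scaleC = scaleR +
  fixes scaleC :: "complex \<Rightarrow> 'a \<Rightarrow> 'a" (infixr "*\<^sub>C" 75)
  assumes scaleR_scaleC: "scaleR r = scaleC (complex_of_real r)"

class complex_vector = scaleC + real_vector +
  assumes scaleC_add_right: "a *\<^sub>C (x + y) = a *\<^sub>C x + a *\<^sub>C y"
    and scaleC_add_left: "(a + b) *\<^sub>C x = a *\<^sub>C x + b *\<^sub>C x"
    and scaleC_scaleC: "a *\<^sub>C b *\<^sub>C x = (a * b) *\<^sub>C x"
    and scaleC_one: "1 *\<^sub>C x = x"

class complex_normed_vector = complex_vector + real_normed_vector +
  assumes norm_scaleC: "norm (a *\<^sub>C x) = cmod a * norm x"

text \<open>Inner product: conjugate-linear in the first, linear in the second argument.\<close>
class complex_inner = complex_normed_vector +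
  fixes cinner :: "'a \<Rightarrow> 'a \<Rightarrow> complex"
  assumes cinner_commute: "cinner x y = cnj (cinner y x)"
    and cinner_add_left: "cinner (x + y) z = cinner x z + cinner y z"
    and cinner_scaleC_left: "cinner (r *\<^sub>C x) y = cnj r * cinner x y"
    and cinner_real_nonneg: "Im (cinner x x) = 0 \<and> 0 \<le> Re (cinner x x)"
    and cinner_eq_zero_iff: "cinner x x = 0 \<longleftrightarrow> x = 0"
    and norm_eq_sqrt_cinner: "norm x = sqrt (Re (cinner x x))"

class chilbert_space = complex_inner + complete_space

definition bounded_clinear :: "('a::complex_normed_vector \<Rightarrow> 'b::complex_normed_vector) \<Rightarrow> bool" where
  "bounded_clinear T \<longleftrightarrow> bounded_linear T \<and> (\<forall>a x. T (a *\<^sub>C x) = a *\<^sub>C T x)"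

definition idOp :: "'a \<Rightarrow> 'a" where "idOp = (\<lambda>x. x)"

definition adj :: "('a::complex_inner \<Rightarrow> 'a) \<Rightarrow> ('a \<Rightarrow> 'a)" where
  "adj T = (THE S. \<forall>x y. cinner (S x) y = cinner x (T y))"

definition positive_op :: "('a::complex_inner \<Rightarrow> 'a) \<Rightarrow> bool" where
  "positive_op A \<longleftrightarrow> bounded_clinear A \<and>
     (\<forall>x. Im (cinner x (A x)) = 0 \<and> 0 \<le> Re (cinner x (A x)))"

definition op_abs :: "('a::complex_inner \<Rightarrow> 'a) \<Rightarrow> ('a \<Rightarrow> 'a)" where
  "op_abs T = (THE S. positive_op S \<and> S \<circ> S = adj T \<circ> T)"

definition orth_proj :: "'a::complex_inner set \<Rightarrow> ('a \<Rightarrow> 'a)" where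
  "orth_proj M = (\<lambda>x. THE y. y \<in> M \<and> (\<forall>m\<in>M. cinner m (x - y) = 0))"

definition range_proj :: "('a::complex_inner \<Rightarrow> 'a) \<Rightarrow> ('a \<Rightarrow> 'a)" where
  "range_proj S = orth_proj (closure (range S))"

definition pos_part :: "('a::complex_inner \<Rightarrow> 'a) \<Rightarrow> ('a \<Rightarrow> 'a)" where
  "pos_part B = (\<lambda>x. (1/2::real) *\<^sub>R (op_abs B x + B x))"

text \<open>Spectral projection of a self-adjoint A associated with (-\<infinity>, c]
  (Riesz's construction of the spectral family: projection onto ker (A - cI)^+).
  For a positive A (e.g. A = |T|) this is the spectral projection associated with [0, c].\<close>
definition spectral_proj_le :: "('a::complex_inner \<Rightarrow> 'a) \<Rightarrow> real \<Rightarrow> ('a \<Rightarrow> 'a)" where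
  "spectral_proj_le A c = orth_proj {x. pos_part (\<lambda>y. A y - c *\<^sub>R y) x = 0}"

end

(* Parts (1) and (2) are duality arguments. If b is orthogonal to the range of T(I - E) and
   z = T^* b, then <(I - E) z, z> = <T (I - E) z, b> = 0, hence
   |z|^2 = <E z, z> = <T E z, b> <= a |z| |b|; this gives |T^* F| <= a. The lower bound
   c |xi| <= |T xi| on the range of I - E passes to T^* on the closure of T(range (I - E)),
   which is the range of I - F, because |T xi|^2 = <T^* T xi, xi> <= |T^* T xi| |T xi| / c.

   For (3) let N and N' be the kernels of (|T| - c)^+ and (|T^*| - c)^+. The intertwining
   relation T |T| = |T^*| T carries over to positive parts, so T maps N into N' and T^* maps N'
   into N; moreover the kernel of T^* lies in N'. These three facts force the closure of
   T(N^perp) to be N'^perp, i.e. F is the projection onto N'; the same argument for T^* gives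
   the range of T^*(I - F).

   The modulus |T| = (T^* T)^(1/2) is obtained from the binomial series of 1 - sqrt (1 - y),
   applied to the contraction I - T^* T / M. In this form it visibly commutes with every
   bounded operator intertwining T^* T with another such product, which is where
   T |T| = |T^*| T comes from. *)

theory Submission
  imports Defs
begin

section \<open>Complex inner product spaces\<close>

subclass (in chilbert_space) banach ..

lemma scaleC_zero_right [simp]: "a *\<^sub>C (0::'a::complex_vector) = 0"
proof -
  have "a *\<^sub>C 0 + a *\<^sub>C 0 = a *\<^sub>C (0::'a) + 0" by (simp flip: scaleC_add_right)
  then show ?thesis by (simp only: add_left_cancel)
qed

lemma scaleC_minus_right: "a *\<^sub>C (- x) = - (a *\<^sub>C (x::'a::complex_vector))"
proof -
  have "a *\<^sub>C (- x) + a *\<^sub>C x = 0" by (simp flip: scaleC_add_right)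
  then show ?thesis by (rule eq_neg_iff_add_eq_0[THEN iffD2])
qed

lemma scaleC_diff_right: "a *\<^sub>C (x - y) = a *\<^sub>C x - a *\<^sub>C (y::'a::complex_vector)"
  using scaleC_add_right[of a x "-y"] by (simp add: scaleC_minus_right)

lemma bounded_linear_scaleC: "bounded_linear (\<lambda>x::'a::complex_normed_vector. a *\<^sub>C x)"
proof
  show "a *\<^sub>C (x + y) = a *\<^sub>C x + a *\<^sub>C y" for x y :: 'a by (rule scaleC_add_right)
  show "a *\<^sub>C (r *\<^sub>R x) = r *\<^sub>R (a *\<^sub>C x)" for r and x :: 'a
    by (simp add: scaleR_scaleC scaleC_scaleC mult.commute)
  show "\<exists>K. \<forall>x::'a. norm (a *\<^sub>C x) \<le> norm x * K"
    by (rule exI[of _ "cmod a"]) (simp add: norm_scaleC mult.commute)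
qed

lemma cinner_add_right: "cinner x (y + z) = cinner x y + cinner (x::'a::complex_inner) z"
  by (subst (1 2 3) cinner_commute) (simp add: cinner_add_left)

lemma cinner_scaleC_right: "cinner x (r *\<^sub>C y) = r * cinner (x::'a::complex_inner) y"
  by (subst (1 2) cinner_commute) (simp add: cinner_scaleC_left)

lemma cinner_zero_left [simp]: "cinner 0 (y::'a::complex_inner) = 0"
  using cinner_add_left[of 0 0 y] by simp

lemma cinner_zero_right [simp]: "cinner (y::'a::complex_inner) 0 = 0"
  using cinner_add_right[of y 0 0] by simp

lemma cinner_minus_left: "cinner (- x) y = - cinner x (y::'a::complex_inner)"
  using cinner_add_left[of "-x" x y] by (simp add: eq_neg_iff_add_eq_0)

lemma cinner_minus_right: "cinner y (- x) = - cinner y (x::'a::complex_inner)"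
  using cinner_add_right[of y "-x" x] by (simp add: eq_neg_iff_add_eq_0)

lemma cinner_diff_left: "cinner (x - y) z = cinner x z - cinner y (z::'a::complex_inner)"
  using cinner_add_left[of x "-y" z] by (simp add: cinner_minus_left)

lemma cinner_diff_right: "cinner z (x - y) = cinner z x - cinner z (y::'a::complex_inner)"
  using cinner_add_right[of z x "-y"] by (simp add: cinner_minus_right)

lemma cinner_scaleR_left: "cinner (r *\<^sub>R x) y = r * cinner x (y::'a::complex_inner)"
  by (simp add: scaleR_scaleC cinner_scaleC_left)

lemma cinner_scaleR_right: "cinner x (r *\<^sub>R y) = r * cinner x (y::'a::complex_inner)"
  by (simp add: scaleR_scaleC cinner_scaleC_right)

lemma cinner_self: "cinner x x = complex_of_real ((norm (x::'a::complex_inner))\<^sup>2)"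
  using norm_eq_sqrt_cinner[of x] cinner_real_nonneg[of x] by (simp add: complex_eq_iff)

lemma Re_cinner_self: "Re (cinner x x) = (norm (x::'a::complex_inner))\<^sup>2"
  by (simp add: cinner_self)

lemma norm_add_power2:
  "(norm (x + y))\<^sup>2 = (norm x)\<^sup>2 + (norm y)\<^sup>2 + 2 * Re (cinner x (y::'a::complex_inner))"
proof -
  have "cinner (x + y) (x + y) = cinner x x + cinner y y + (cinner x y + cnj (cinner x y))"
    by (simp add: cinner_add_left cinner_add_right cinner_commute[of y x])
  then show ?thesis
    by (simp flip: Re_cinner_self)
qed

lemma norm_diff_power2:
  "(norm (x - y))\<^sup>2 = (norm x)\<^sup>2 + (norm y)\<^sup>2 - 2 * Re (cinner x (y::'a::complex_inner))"
  using norm_add_power2[of x "-y"] by (simp add: cinner_minus_right)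

lemma Cauchy_Schwarz_cinner: "cmod (cinner x y) \<le> norm x * norm (y::'a::complex_inner)"
proof (cases "y = 0")
  case False
  define t where "t = cinner y x / complex_of_real ((norm y)\<^sup>2)"
  have ny: "norm y > 0" using False by simp
  have "0 \<le> (norm (x - t *\<^sub>C y))\<^sup>2" by simp
  also have "\<dots> = (norm x)\<^sup>2 + (cmod t)\<^sup>2 * (norm y)\<^sup>2 - 2 * Re (t * cinner x y)"
    by (simp only: norm_diff_power2 norm_scaleC power_mult_distrib cinner_scaleC_right)
  also have "t * cinner x y = complex_of_real ((cmod (cinner x y))\<^sup>2 / (norm y)\<^sup>2)"
    unfolding t_def using cinner_commute[of y x] complex_norm_square[of "cinner x y"]
    by (simp add: mult.commute)
  also have "cmod t = cmod (cinner x y) / (norm y)\<^sup>2"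
    unfolding t_def using ny cinner_commute[of y x] by (simp add: norm_divide norm_power)
  finally have "(cmod (cinner x y))\<^sup>2 \<le> (norm x)\<^sup>2 * (norm y)\<^sup>2"
    using ny by (simp add: field_simps power2_eq_square)
  then have "(cmod (cinner x y))\<^sup>2 \<le> (norm x * norm y)\<^sup>2" by (simp add: power_mult_distrib)
  then show ?thesis by (rule power2_le_imp_le) simp
qed simp

lemma Re_cinner_le: "Re (cinner x y) \<le> norm x * norm (y::'a::complex_inner)"
  using complex_Re_le_cmod Cauchy_Schwarz_cinner order_trans by blast

lemma bounded_bilinear_cinner: "bounded_bilinear (cinner :: 'a::complex_inner \<Rightarrow> 'a \<Rightarrow> complex)"
proof
  show "\<exists>K. \<forall>a b::'a. norm (cinner a b) \<le> norm a * norm b * K"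
    by (rule exI[of _ 1]) (simp add: Cauchy_Schwarz_cinner)
qed (simp_all add: cinner_add_left cinner_add_right cinner_scaleR_left cinner_scaleR_right
      scaleR_conv_of_real)

lemma continuous_on_cinner_left: "continuous_on S (\<lambda>m. cinner m y)"
  using bounded_bilinear.bounded_linear_left[OF bounded_bilinear_cinner]
  by (intro linear_continuous_on) auto

lemma continuous_on_cinner_right: "continuous_on S (cinner y)"
  using bounded_bilinear.bounded_linear_right[OF bounded_bilinear_cinner]
  by (intro linear_continuous_on) auto

lemma cinner_ext: "(\<And>z. cinner x z = cinner y z) \<Longrightarrow> x = (y::'a::complex_inner)"
  by (metis cinner_diff_left cinner_eq_zero_iff right_minus_eq)

lemma square_le_mult_imp_le:
  fixes x k :: real
  assumes "0 \<le> k" and "x\<^sup>2 \<le> k * x"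
  shows "x \<le> k"
  using assms by (cases "x > 0") (auto simp: power2_eq_square)

section \<open>Closed subspaces and orthogonal projections\<close>

definition csubspace :: "'a::complex_vector set \<Rightarrow> bool" where
  "csubspace M \<longleftrightarrow> 0 \<in> M \<and> (\<forall>x\<in>M. \<forall>y\<in>M. x + y \<in> M) \<and> (\<forall>a. \<forall>x\<in>M. a *\<^sub>C x \<in> M)"

definition orthogonal_complement :: "'a::complex_inner set \<Rightarrow> 'a set" where
  "orthogonal_complement M = {y. \<forall>m\<in>M. cinner m y = 0}"

lemma csubspace_0: "csubspace M \<Longrightarrow> 0 \<in> M"
  by (simp add: csubspace_def)

lemma csubspace_add: "csubspace M \<Longrightarrow> x \<in> M \<Longrightarrow> y \<in> M \<Longrightarrow> x + y \<in> M"
  by (simp add: csubspace_def)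

lemma csubspace_scaleC: "csubspace M \<Longrightarrow> x \<in> M \<Longrightarrow> a *\<^sub>C x \<in> M"
  by (simp add: csubspace_def)

lemma csubspace_scaleR: "csubspace M \<Longrightarrow> x \<in> M \<Longrightarrow> r *\<^sub>R x \<in> M"
  by (simp add: csubspace_def scaleR_scaleC)

lemma csubspace_diff: "csubspace M \<Longrightarrow> x \<in> M \<Longrightarrow> y \<in> M \<Longrightarrow> x - y \<in> M"
  using csubspace_add[of M x "(-1) *\<^sub>R y"] csubspace_scaleR[of M y "-1"] by simp

lemma csubspace_closure:
  fixes S :: "'a::complex_normed_vector set"
  assumes S: "csubspace S"
  shows "csubspace (closure S)"
proof -
  have "x + y \<in> closure S" if xy: "x \<in> closure S" "y \<in> closure S" for x y
  proof -
    obtain f g where f: "\<forall>n. f n \<in> S" "f \<longlonglongrightarrow> x" and g: "\<forall>n. g n \<in> S" "g \<longlonglongrightarrow> y"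
      using xy unfolding closure_sequential by blast
    show ?thesis unfolding closure_sequential
      by (intro exI[of _ "\<lambda>n. f n + g n"] conjI allI csubspace_add[OF S] tendsto_add)
        (simp_all add: f g)
  qed
  moreover have "a *\<^sub>C x \<in> closure S" if x: "x \<in> closure S" for a x
  proof -
    obtain f where f: "\<forall>n. f n \<in> S" "f \<longlonglongrightarrow> x"
      using x unfolding closure_sequential by blast
    show ?thesis unfolding closure_sequential
      by (intro exI[of _ "\<lambda>n. a *\<^sub>C f n"] conjI allI csubspace_scaleC[OF S]
          bounded_linear.tendsto[OF bounded_linear_scaleC]) (simp_all add: f)
  qed
  ultimately show ?thesis
    using csubspace_0[OF S] closure_subset unfolding csubspace_def by blast
qed

lemma bounded_clinear_bounded_linear: "bounded_clinear T \<Longrightarrow> bounded_linear T"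
  by (simp add: bounded_clinear_def)

lemma bounded_clinear_scaleC: "bounded_clinear T \<Longrightarrow> T (a *\<^sub>C x) = a *\<^sub>C T x"
  by (simp add: bounded_clinear_def)

lemma csubspace_image:
  assumes T: "bounded_clinear T" and S: "csubspace S"
  shows "csubspace (T ` S)"
proof -
  interpret T: bounded_linear T by (rule bounded_clinear_bounded_linear[OF T])
  have "T x + T y \<in> T ` S" if "x \<in> S" "y \<in> S" for x y
    using T.add[of x y] csubspace_add[OF S that] by (metis image_eqI)
  moreover have "a *\<^sub>C T x \<in> T ` S" if "x \<in> S" for a x
    using bounded_clinear_scaleC[OF T, of a x] csubspace_scaleC[OF S that] by (metis image_eqI)
  moreover have "0 \<in> T ` S"
    using csubspace_0[OF S] T.zero by (metis image_eqI)
  ultimately show ?thesis unfolding csubspace_def by blast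
qed

lemma csubspace_UNIV: "csubspace UNIV"
  by (simp add: csubspace_def)

lemma closed_csubspace_kernel:
  assumes Q: "bounded_clinear Q"
  shows "closed {x. Q x = 0}" "csubspace {x. Q x = 0}"
proof -
  interpret Q: bounded_linear Q by (rule bounded_clinear_bounded_linear[OF Q])
  show "closed {x. Q x = 0}"
    using closed_Collect_eq[of Q "\<lambda>_. 0"] linear_continuous_on[OF Q.bounded_linear] by simp
  show "csubspace {x. Q x = 0}" unfolding csubspace_def
    using Q.add Q.zero bounded_clinear_scaleC[OF Q] by simp
qed

lemma closed_orthogonal_complement: "closed (orthogonal_complement (M::'a::complex_inner set))"
proof -
  have "orthogonal_complement M = (\<Inter>m\<in>M. {y. cinner m y = 0})"
    unfolding orthogonal_complement_def by auto
  moreover have "closed {y. cinner m y = 0}" for m :: 'a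
    by (rule closed_Collect_eq[OF continuous_on_cinner_right continuous_on_const])
  ultimately show ?thesis by auto
qed

lemma csubspace_orthogonal_complement:
  "csubspace (orthogonal_complement (M::'a::complex_inner set))"
  unfolding csubspace_def orthogonal_complement_def
  by (auto simp: cinner_add_right cinner_scaleC_right)

lemma orthogonal_complement_closure:
  "orthogonal_complement (closure S) = orthogonal_complement (S::'a::complex_inner set)"
proof
  show "orthogonal_complement (closure S) \<subseteq> orthogonal_complement S"
    unfolding orthogonal_complement_def using closure_subset by blast
  show "orthogonal_complement S \<subseteq> orthogonal_complement (closure S)"
  proof
    fix y assume y: "y \<in> orthogonal_complement S"
    have "closed {m. cinner m y = 0}"
      by (rule closed_Collect_eq[OF continuous_on_cinner_left continuous_on_const])
    moreover have "S \<subseteq> {m. cinner m y = 0}" using y unfolding orthogonal_complement_def by blast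
    ultimately have "closure S \<subseteq> {m. cinner m y = 0}" by (rule closure_minimal[rotated])
    then show "y \<in> orthogonal_complement (closure S)" unfolding orthogonal_complement_def by blast
  qed
qed

lemma parallelogram_law:
  "(norm (u + v))\<^sup>2 + (norm (u - v))\<^sup>2 = 2 * (norm u)\<^sup>2 + 2 * (norm (v::'a::complex_inner))\<^sup>2"
  by (simp add: norm_add_power2 norm_diff_power2)

lemma Cauchy_if_power2_norm_diff_le:
  fixes f :: "nat \<Rightarrow> 'a::real_normed_vector"
  assumes "\<And>i j. (norm (f i - f j))\<^sup>2 \<le> 2 / (real i + 1) + 2 / (real j + 1)"
  shows "Cauchy f"
proof (rule CauchyI)
  fix e :: real assume e: "0 < e"
  obtain N :: nat where "4 / e\<^sup>2 < real N" using reals_Archimedean2 by blast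
  then have "4 < real N * e\<^sup>2" using e by (simp add: pos_divide_less_eq)
  also have "\<dots> \<le> (real N + 1) * e\<^sup>2" by (simp add: distrib_right)
  finally have N: "4 / (real N + 1) < e\<^sup>2" by (simp add: pos_divide_less_eq mult.commute)
  have "norm (f m - f n) < e" if "N \<le> m" "N \<le> n" for m n
  proof -
    have "2 / (real m + 1) \<le> 2 / (real N + 1)" "2 / (real n + 1) \<le> 2 / (real N + 1)"
      using that by (auto intro!: divide_left_mono)
    then have "(norm (f m - f n))\<^sup>2 < e\<^sup>2" using assms[of m n] N by simp
    then show ?thesis using e by (simp add: power_less_imp_less_base)
  qed
  then show "\<exists>M. \<forall>m\<ge>M. \<forall>n\<ge>M. norm (f m - f n) < e" by blast
qed

lemma power2_norm_diff_le_if_almost_closest: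
  fixes M :: "'a::complex_inner set"
  assumes M: "csubspace M" and uv: "u \<in> M" "v \<in> M"
    and d: "0 \<le> d" "\<And>m. m \<in> M \<Longrightarrow> d \<le> norm (x - m)"
    and u: "(norm (x - u))\<^sup>2 \<le> d\<^sup>2 + r" and v: "(norm (x - v))\<^sup>2 \<le> d\<^sup>2 + s"
  shows "(norm (u - v))\<^sup>2 \<le> 2 * r + 2 * s"
proof -
  \<comment> \<open>the midpoint of \<open>u\<close> and \<open>v\<close> lies in \<open>M\<close>, so it is at distance at least \<open>d\<close> from \<open>x\<close>\<close>
  have "(1/2::real) *\<^sub>R (u + v) \<in> M" using M uv by (intro csubspace_scaleR csubspace_add)
  then have "2 * d \<le> 2 * norm (x - (1/2::real) *\<^sub>R (u + v))" using d(2) by simp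
  also have "2 * norm (x - (1/2::real) *\<^sub>R (u + v)) = norm ((x - u) + (x - v))"
  proof -
    have "(x - u) + (x - v) = 2 *\<^sub>R (x - (1/2::real) *\<^sub>R (u + v))"
      by (simp add: algebra_simps scaleR_2)
    then show ?thesis by simp
  qed
  finally have "(2 * d)\<^sup>2 \<le> (norm ((x - u) + (x - v)))\<^sup>2"
    using d(1) by (intro power_mono) auto
  then have "4 * d\<^sup>2 \<le> (norm ((x - u) + (x - v)))\<^sup>2" by (simp add: power_mult_distrib)
  moreover have "(norm ((x - u) + (x - v)))\<^sup>2 + (norm (u - v))\<^sup>2
      = 2 * (norm (x - u))\<^sup>2 + 2 * (norm (x - v))\<^sup>2"
    using parallelogram_law[of "x - u" "x - v"] by (simp add: norm_minus_commute)
  ultimately show ?thesis using u v by linarith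
qed

lemma closest_point_exists:
  fixes M :: "'a::chilbert_space set"
  assumes M: "closed M" "csubspace M"
  shows "\<exists>y\<in>M. \<forall>m\<in>M. norm (x - y) \<le> norm (x - m)"
proof -
  define d where "d = Inf ((\<lambda>m. norm (x - m)) ` M)"
  have ne: "(\<lambda>m. norm (x - m)) ` M \<noteq> {}" using csubspace_0[OF M(2)] by auto
  have bdd: "bdd_below ((\<lambda>m. norm (x - m)) ` M)" by (rule bdd_belowI[of _ 0]) auto
  have d_le: "d \<le> norm (x - m)" if "m \<in> M" for m
    unfolding d_def using bdd that by (auto intro!: cInf_lower)
  have d0: "0 \<le> d" unfolding d_def using ne by (auto intro!: cInf_greatest)
  have "\<exists>m\<in>M. (norm (x - m))\<^sup>2 < d\<^sup>2 + 1 / (real n + 1)" for n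
  proof -
    have "d < sqrt (d\<^sup>2 + 1 / (real n + 1))"
      by (rule real_less_rsqrt) simp
    then obtain m where m: "m \<in> M" "norm (x - m) < sqrt (d\<^sup>2 + 1 / (real n + 1))"
      using cInf_lessD[OF ne, of "sqrt (d\<^sup>2 + 1 / (real n + 1))"] unfolding d_def by auto
    then have "(norm (x - m))\<^sup>2 < d\<^sup>2 + 1 / (real n + 1)"
      using power_strict_mono[OF m(2) norm_ge_zero, of 2] by simp
    with m show ?thesis by blast
  qed
  then obtain f where f: "\<And>n. f n \<in> M" "\<And>n. (norm (x - f n))\<^sup>2 < d\<^sup>2 + 1 / (real n + 1)"
    by metis
  have "Cauchy f"
    using power2_norm_diff_le_if_almost_closest[OF M(2) f(1) f(1) d0 d_le less_imp_le[OF f(2)]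
        less_imp_le[OF f(2)]]
    by (intro Cauchy_if_power2_norm_diff_le) simp
  then obtain y where y: "f \<longlonglongrightarrow> y" using Cauchy_convergent_iff convergent_def by blast
  have lim: "(\<lambda>n. d\<^sup>2 + 1 / (real n + 1)) \<longlonglongrightarrow> d\<^sup>2 + 0"
  proof (rule tendsto_add[OF tendsto_const])
    show "(\<lambda>n. 1 / (real n + 1)) \<longlonglongrightarrow> 0"
      using LIMSEQ_inverse_real_of_nat by (simp add: inverse_eq_divide add.commute)
  qed
  have "(\<lambda>n. (norm (x - f n))\<^sup>2) \<longlonglongrightarrow> (norm (x - y))\<^sup>2"
    by (intro tendsto_intros y)
  then have "(norm (x - y))\<^sup>2 \<le> d\<^sup>2 + 0"
    by (rule LIMSEQ_le[OF _ lim]) (use f(2) in \<open>blast intro: less_imp_le\<close>)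
  then have "norm (x - y) \<le> d" using d0 by (rule_tac power2_le_imp_le) simp_all
  moreover have "y \<in> M" using M(1) f(1) y closed_sequentially by blast
  ultimately show ?thesis using d_le by (blast intro: order_trans)
qed

lemma orth_proj_exists:
  fixes M :: "'a::chilbert_space set"
  assumes M: "closed M" "csubspace M"
  shows "\<exists>y\<in>M. \<forall>m\<in>M. cinner m (x - y) = 0"
proof -
  obtain y where yM: "y \<in> M" and y: "\<And>m. m \<in> M \<Longrightarrow> norm (x - y) \<le> norm (x - m)"
    using closest_point_exists[OF M, of x] by blast
  have "cinner m (x - y) = 0" if mM: "m \<in> M" for m
  proof (rule ccontr)
    \<comment> \<open>otherwise moving from \<open>y\<close> a little in direction \<open>m\<close> would bring us closer to \<open>x\<close>\<close>
    define w where "w = cinner m (x - y)"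
    define z where "z = x - y"
    assume "cinner m (x - y) \<noteq> 0"
    then have w0: "cmod w > 0" unfolding w_def by simp
    define s where "s = 1 / ((norm m)\<^sup>2 + 1)"
    have "0 < (norm m)\<^sup>2 + 1" by (rule add_nonneg_pos) simp_all
    then have s0: "s > 0" and s1: "s * (norm m)\<^sup>2 < 1"
      unfolding s_def by (simp_all add: divide_less_eq)
    define t where "t = complex_of_real s * w"
    have "y + t *\<^sub>C m \<in> M" using M(2) yM mM by (intro csubspace_add csubspace_scaleC)
    then have "norm z \<le> norm (z - t *\<^sub>C m)" using y[of "y + t *\<^sub>C m"] unfolding z_def
      by (simp add: algebra_simps)
    then have "(norm z)\<^sup>2 \<le> (norm (z - t *\<^sub>C m))\<^sup>2" by (rule power_mono) simp
    also have "\<dots> = (norm z)\<^sup>2 + (norm (t *\<^sub>C m))\<^sup>2 - 2 * Re (cinner z (t *\<^sub>C m))"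
      by (rule norm_diff_power2)
    also have "cinner z (t *\<^sub>C m) = complex_of_real (s * (cmod w)\<^sup>2)"
    proof -
      have "cinner z (t *\<^sub>C m) = complex_of_real s * (w * cnj w)" unfolding w_def z_def t_def
        by (simp add: cinner_scaleC_right cinner_commute[of "x - y" m] mult.assoc)
      then show ?thesis by (simp add: complex_norm_square[symmetric])
    qed
    also have "(norm (t *\<^sub>C m))\<^sup>2 = s\<^sup>2 * (cmod w)\<^sup>2 * (norm m)\<^sup>2"
      unfolding t_def using s0 by (simp add: norm_scaleC norm_mult power_mult_distrib)
    finally have "2 * s * (cmod w)\<^sup>2 \<le> (s * (norm m)\<^sup>2) * (s * (cmod w)\<^sup>2)"
      by (simp add: power2_eq_square algebra_simps)
    also have "\<dots> < 1 * (s * (cmod w)\<^sup>2)" using s1 s0 w0 by (intro mult_strict_right_mono) simp_all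
    finally show False using s0 w0 by simp
  qed
  with yM show ?thesis by blast
qed

lemma orth_proj_unique:
  fixes M :: "'a::complex_inner set"
  assumes M: "csubspace M" and "y1 \<in> M" "y2 \<in> M"
    and "\<forall>m\<in>M. cinner m (x - y1) = 0" "\<forall>m\<in>M. cinner m (x - y2) = 0"
  shows "y1 = y2"
proof -
  have d: "y1 - y2 \<in> M" using assms csubspace_diff by blast
  have "cinner (y1 - y2) (y1 - y2) = cinner (y1 - y2) (x - y2) - cinner (y1 - y2) (x - y1)"
    by (simp add: cinner_diff_right)
  also have "\<dots> = 0" using assms d by simp
  finally have "y1 - y2 = 0" by (simp only: cinner_eq_zero_iff)
  then show ?thesis by simp
qed

context
  fixes M :: "'a::chilbert_space set"
  assumes M: "closed M" "csubspace M"
begin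

lemma orth_proj_spec:
  "orth_proj M x \<in> M \<and> (\<forall>m\<in>M. cinner m (x - orth_proj M x) = 0)"
proof -
  have "\<exists>!y. y \<in> M \<and> (\<forall>m\<in>M. cinner m (x - y) = 0)"
    using orth_proj_exists[OF M, of x] orth_proj_unique[OF M(2)] by blast
  then show ?thesis unfolding orth_proj_def by (rule theI')
qed

lemma orth_proj_in: "orth_proj M x \<in> M"
  using orth_proj_spec by blast

lemma orth_proj_residual: "x - orth_proj M x \<in> orthogonal_complement M"
  using orth_proj_spec unfolding orthogonal_complement_def by blast

lemma orth_proj_eq:
  assumes "y \<in> M" and "\<And>m. m \<in> M \<Longrightarrow> cinner m (x - y) = 0"
  shows "orth_proj M x = y"
  using orth_proj_unique[OF M(2) orth_proj_in \<open>y \<in> M\<close>, of x] orth_proj_spec assms(2) by blast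

lemma orth_proj_fixpoint: "m \<in> M \<Longrightarrow> orth_proj M m = m"
  by (rule orth_proj_eq) simp_all

lemma range_orth_proj: "range (orth_proj M) = M"
  using orth_proj_in orth_proj_fixpoint by (metis image_subsetI rangeI subsetI subset_antisym)

lemma norm_orth_proj_le: "norm (orth_proj M x) \<le> norm x"
proof -
  have "cinner (orth_proj M x) (x - orth_proj M x) = 0"
    using orth_proj_spec by blast
  then have "(norm x)\<^sup>2 = (norm (orth_proj M x))\<^sup>2 + (norm (x - orth_proj M x))\<^sup>2"
    using norm_add_power2[of "orth_proj M x" "x - orth_proj M x"] by simp
  then have "(norm (orth_proj M x))\<^sup>2 \<le> (norm x)\<^sup>2" by simp
  then show ?thesis by (rule power2_le_imp_le) simp
qed

lemma orthogonal_complement_orthogonal_complement: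
  "orthogonal_complement (orthogonal_complement M) = M"
proof
  show "M \<subseteq> orthogonal_complement (orthogonal_complement M)"
  proof (unfold orthogonal_complement_def, intro subsetI CollectI ballI)
    fix m y assume "m \<in> M" "y \<in> {y. \<forall>m\<in>M. cinner m y = 0}"
    then have "cinner m y = 0" by blast
    then show "cinner y m = 0" by (subst cinner_commute) simp
  qed
  show "orthogonal_complement (orthogonal_complement M) \<subseteq> M"
  proof
    fix x assume x: "x \<in> orthogonal_complement (orthogonal_complement M)"
    have "x - orth_proj M x \<in> orthogonal_complement M" by (rule orth_proj_residual)
    then have "cinner (x - orth_proj M x) x = 0"
      using x unfolding orthogonal_complement_def by blast
    moreover have "cinner (orth_proj M x) (x - orth_proj M x) = 0"
      using orth_proj_spec by blast
    then have "cinner (x - orth_proj M x) (orth_proj M x) = 0"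
      by (subst cinner_commute) simp
    ultimately have "cinner (x - orth_proj M x) (x - orth_proj M x) = 0"
      by (simp add: cinner_diff_right)
    then have "x = orth_proj M x" by (simp only: cinner_eq_zero_iff right_minus_eq)
    then show "x \<in> M" using orth_proj_in[of x] by simp
  qed
qed

end

lemma orth_proj_orthogonal_complement:
  fixes M :: "'a::chilbert_space set"
  assumes M: "closed M" "csubspace M"
  shows "orth_proj (orthogonal_complement M) x = x - orth_proj M x"
proof (rule orth_proj_eq[OF closed_orthogonal_complement csubspace_orthogonal_complement])
  show "x - orth_proj M x \<in> orthogonal_complement M" by (rule orth_proj_residual[OF M])
  fix n assume "n \<in> orthogonal_complement M"
  then have "cinner (orth_proj M x) n = 0"
    using orth_proj_in[OF M] unfolding orthogonal_complement_def by blast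
  then show "cinner n (x - (x - orth_proj M x)) = 0" by (subst cinner_commute) simp
qed

lemma in_orthogonal_complement_self:
  assumes "x \<in> M" and "x \<in> orthogonal_complement M"
  shows "x = (0::'a::complex_inner)"
proof -
  have "cinner x x = 0" using assms unfolding orthogonal_complement_def by blast
  then show ?thesis by (simp only: cinner_eq_zero_iff)
qed

lemma diff_orth_proj_orthogonal_complement:
  fixes M :: "'a::chilbert_space set"
  assumes "closed M" "csubspace M"
  shows "x - orth_proj (orthogonal_complement M) x = orth_proj M x"
  by (simp add: orth_proj_orthogonal_complement[OF assms])

section \<open>Adjoints\<close>

lemma bounded_clinear_intro:
  fixes S :: "'a::complex_normed_vector \<Rightarrow> 'b::complex_normed_vector"
  assumes "\<And>x y. S (x + y) = S x + S y" "\<And>a x. S (a *\<^sub>C x) = a *\<^sub>C S x"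
    and "\<And>x. norm (S x) \<le> norm x * K"
  shows "bounded_clinear S"
  unfolding bounded_clinear_def
proof (intro conjI allI)
  show "bounded_linear S"
  proof
    show "S (r *\<^sub>R x) = r *\<^sub>R S x" for r x using assms(2) by (simp add: scaleR_scaleC)
  qed (use assms in blast)+
qed (rule assms(2))

lemma bounded_clinear_comp:
  "bounded_clinear S \<Longrightarrow> bounded_clinear T \<Longrightarrow> bounded_clinear (S \<circ> T)"
  unfolding bounded_clinear_def by (auto intro: bounded_linear_compose simp: o_def)

lemma bounded_clinear_ident: "bounded_clinear (\<lambda>x. x)"
  unfolding bounded_clinear_def by simp

lemma bounded_clinear_add:
  "bounded_clinear S \<Longrightarrow> bounded_clinear T \<Longrightarrow> bounded_clinear (\<lambda>x. S x + T x)"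
  unfolding bounded_clinear_def by (auto intro: bounded_linear_add simp: scaleC_add_right)

lemma bounded_clinear_diff:
  "bounded_clinear S \<Longrightarrow> bounded_clinear T \<Longrightarrow> bounded_clinear (\<lambda>x. S x - T x)"
  unfolding bounded_clinear_def by (auto intro: bounded_linear_sub simp: scaleC_diff_right)

lemma bounded_clinear_scaleR:
  assumes S: "bounded_clinear S"
  shows "bounded_clinear (\<lambda>x. r *\<^sub>R S x)"
  unfolding bounded_clinear_def
proof (intro conjI allI)
  show "bounded_linear (\<lambda>x. r *\<^sub>R S x)"
    using bounded_linear_compose[OF bounded_linear_scaleR_right
        bounded_clinear_bounded_linear[OF S]]
    by simp
  show "r *\<^sub>R S (a *\<^sub>C x) = a *\<^sub>C (r *\<^sub>R S x)" for a x
    by (simp add: bounded_clinear_scaleC[OF S] scaleR_scaleC scaleC_scaleC mult.commute)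
qed

lemma bounded_clinear_funpow:
  fixes Y :: "'a::complex_normed_vector \<Rightarrow> 'a"
  shows "bounded_clinear Y \<Longrightarrow> bounded_clinear (Y ^^ k)"
proof (induction k)
  case 0
  show ?case unfolding funpow.simps(1) id_def by (rule bounded_clinear_ident)
next
  case (Suc k)
  then show ?case unfolding funpow.simps(2) by (intro bounded_clinear_comp) simp_all
qed

lemma riesz_representation:
  fixes f :: "'a::chilbert_space \<Rightarrow> complex"
  assumes f: "bounded_linear f" and f_scaleC: "\<And>a x. f (a *\<^sub>C x) = a * f x"
  shows "\<exists>z. \<forall>x. f x = cinner z x"
proof (cases "\<forall>x. f x = 0")
  case True
  then show ?thesis by (intro exI[of _ 0]) simp
next
  case False
  interpret f: bounded_linear f by (rule f)
  obtain w where fw: "f w \<noteq> 0" using False by blast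
  define K where "K = {x. f x = 0}"
  have K: "closed K" "csubspace K"
    unfolding K_def csubspace_def
    using closed_Collect_eq[OF linear_continuous_on[OF f] continuous_on_const] f.add f.zero f_scaleC
    by simp_all
  \<comment> \<open>a nonzero vector orthogonal to the kernel spans the representing direction\<close>
  define u where "u = w - orth_proj K w"
  have uK: "u \<in> orthogonal_complement K" unfolding u_def by (rule orth_proj_residual[OF K])
  have fu: "f u = f w" unfolding u_def using orth_proj_in[OF K, of w] f.diff by (simp add: K_def)
  then have u0: "u \<noteq> 0" using fw f.zero by auto
  have "f x = cinner ((cnj (f u) / complex_of_real ((norm u)\<^sup>2)) *\<^sub>C u) x" for x
  proof -
    have "f (f x *\<^sub>C u - f u *\<^sub>C x) = 0" using f.diff f_scaleC by (simp add: mult.commute)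
    then have "cinner (f x *\<^sub>C u - f u *\<^sub>C x) u = 0"
      using uK unfolding K_def orthogonal_complement_def by blast
    then have "cnj (cnj (f x) * cinner u u - cnj (f u) * cinner x u) = 0"
      by (simp add: cinner_diff_left cinner_scaleC_left)
    then have "f x * complex_of_real ((norm u)\<^sup>2) = f u * cinner u x"
      by (simp add: cinner_commute[of x u] cinner_self)
    then show ?thesis using u0 by (simp add: cinner_scaleC_left field_simps)
  qed
  then show ?thesis by blast
qed

lemma adj_unique:
  assumes "\<And>x y. cinner (S x) y = cinner x (T y)"
  shows "adj T = S"
  unfolding adj_def
proof (rule the_equality)
  show "\<forall>x y. cinner (S x) y = cinner x (T y)" using assms by blast
  fix S' assume "\<forall>x y. cinner (S' x) y = cinner x (T y)"
  then show "S' = S" using assms by (intro ext cinner_ext) simp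
qed

context
  fixes T :: "'a::chilbert_space \<Rightarrow> 'a"
  assumes T: "bounded_clinear T"
begin

lemma cinner_adj_left: "cinner (adj T x) y = cinner x (T y)"
proof -
  have "\<exists>z. \<forall>y. cinner x (T y) = cinner z y" for x
  proof (rule riesz_representation)
    show "bounded_linear (\<lambda>y. cinner x (T y))"
      using bounded_linear_compose[OF
          bounded_bilinear.bounded_linear_right[OF bounded_bilinear_cinner]
          bounded_clinear_bounded_linear[OF T]] by simp
    show "cinner x (T (a *\<^sub>C y)) = a * cinner x (T y)" for a y
      by (simp add: bounded_clinear_scaleC[OF T] cinner_scaleC_right)
  qed
  then obtain S where S: "\<And>x y. cinner (S x) y = cinner x (T y)" by metis
  show ?thesis using adj_unique[OF S] S by simp
qed

lemma cinner_adj_right: "cinner x (adj T y) = cinner (T x) y"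
  using cinner_adj_left[of y x] by (metis cinner_commute)

lemma bounded_clinear_adj: "bounded_clinear (adj T)"
proof -
  obtain K where K: "\<And>x. norm (T x) \<le> norm x * K" "K > 0"
    using bounded_linear.pos_bounded[OF bounded_clinear_bounded_linear[OF T]] by blast
  show ?thesis
  proof (rule bounded_clinear_intro)
    show "adj T (x + y) = adj T x + adj T y" for x y
      by (rule cinner_ext) (simp add: cinner_adj_left cinner_add_left)
    show "adj T (a *\<^sub>C x) = a *\<^sub>C adj T x" for a x
      by (rule cinner_ext) (simp add: cinner_adj_left cinner_scaleC_left)
    show "norm (adj T x) \<le> norm x * K" for x
    proof (rule square_le_mult_imp_le)
      have "(norm (adj T x))\<^sup>2 = Re (cinner x (T (adj T x)))"
        by (simp add: cinner_adj_left flip: Re_cinner_self)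
      also have "\<dots> \<le> norm x * norm (T (adj T x))" by (rule Re_cinner_le)
      also have "\<dots> \<le> norm x * (norm (adj T x) * K)"
        using K(1)[of "adj T x"] by (simp add: mult_left_mono)
      also have "\<dots> = norm x * K * norm (adj T x)" by simp
      finally show "(norm (adj T x))\<^sup>2 \<le> norm x * K * norm (adj T x)" .
    qed (use K(2) in simp)
  qed
qed

lemma adj_adj: "adj (adj T) = T"
  by (rule adj_unique) (simp add: cinner_adj_right)

end

definition selfadj :: "('a::complex_inner \<Rightarrow> 'a) \<Rightarrow> bool" where
  "selfadj A \<longleftrightarrow> (\<forall>x y. cinner (A x) y = cinner x (A y))"

lemma adj_selfadj: "selfadj A \<Longrightarrow> adj A = A"
  unfolding selfadj_def by (rule adj_unique) simp

lemma selfadj_funpow: "selfadj Y \<Longrightarrow> selfadj (Y ^^ k)"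
  by (induction k) (simp_all add: selfadj_def funpow_swap1)

lemma selfadj_diff_scaleR: "selfadj A \<Longrightarrow> selfadj (\<lambda>y. A y - c *\<^sub>R y)"
  unfolding selfadj_def
  by (simp add: cinner_diff_left cinner_diff_right cinner_scaleR_left cinner_scaleR_right)

lemma Im_cinner_selfadj:
  assumes "selfadj A"
  shows "Im (cinner v (A v)) = 0"
proof -
  have "cinner v (A v) = cnj (cinner v (A v))"
    using assms unfolding selfadj_def by (metis cinner_commute)
  then have "Im (cinner v (A v)) = Im (cnj (cinner v (A v)))" by (rule arg_cong)
  then show ?thesis by simp
qed

section \<open>Positive operators\<close>

lemma positive_op_bounded_clinear: "positive_op A \<Longrightarrow> bounded_clinear A"
  unfolding positive_op_def by blast

lemma selfadj_if_real_quadratic_form: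
  fixes S :: "'a::complex_inner \<Rightarrow> 'a"
  assumes S: "bounded_clinear S" and real: "\<And>x. Im (cinner x (S x)) = 0"
  shows "selfadj S"
  unfolding selfadj_def
proof (intro allI)
  fix u v :: 'a
  interpret S: bounded_linear S by (rule bounded_clinear_bounded_linear[OF S])
  have quad: "cinner (x + y) (S (x + y)) =
      cinner x (S x) + cinner y (S y) + cinner x (S y) + cinner y (S x)" for x y
    by (simp add: S.add cinner_add_left cinner_add_right)
  define a where "a = cinner u (S v)"
  define b where "b = cinner v (S u)"
  have "Im (a + b) = 0"
    using real[of "u + v"] real[of u] real[of v] unfolding quad a_def b_def by simp
  moreover have "Re a - Re b = 0"
  proof -
    have iv: "S (\<i> *\<^sub>C v) = \<i> *\<^sub>C S v" by (rule bounded_clinear_scaleC[OF S])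
    have "cinner (\<i> *\<^sub>C v) (S (\<i> *\<^sub>C v)) = cinner v (S v)"
      unfolding iv by (simp add: cinner_scaleC_left cinner_scaleC_right)
    then have "Im (cinner u (S (\<i> *\<^sub>C v)) + cinner (\<i> *\<^sub>C v) (S u)) = 0"
      using real[of "u + \<i> *\<^sub>C v"] real[of u] real[of v] unfolding quad by simp
    then show ?thesis
      unfolding iv a_def b_def by (simp add: cinner_scaleC_left cinner_scaleC_right)
  qed
  ultimately have "a = cnj b" by (simp add: complex_eq_iff)
  then show "cinner (S u) v = cinner u (S v)" unfolding a_def b_def
    by (metis cinner_commute)
qed

lemma positive_op_selfadj: "positive_op S \<Longrightarrow> selfadj S"
  unfolding positive_op_def by (intro selfadj_if_real_quadratic_form) auto

lemma linear_coeff_eq_0_if_quadratic_nonneg: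
  fixes a b :: real
  assumes "0 \<le> a" and "0 \<le> b" and nonneg: "\<And>t. 0 \<le> 2 * t * a + t\<^sup>2 * b"
  shows "a = 0"
proof (rule ccontr)
  assume "a \<noteq> 0"
  then have a0: "a > 0" using \<open>0 \<le> a\<close> by simp
  define s where "s = a / (b + 1)"
  have bp: "b + 1 > 0" using \<open>0 \<le> b\<close> by simp
  have s0: "s > 0" unfolding s_def using a0 bp by simp
  have "0 \<le> 2 * (- s) * a + (- s)\<^sup>2 * b" by (rule nonneg)
  then have "s * (2 * a) \<le> s * (s * b)" by (simp add: power2_eq_square algebra_simps)
  then have "2 * a \<le> s * b" using s0 by (rule mult_left_le_imp_le)
  also have "s * b = a * (b / (b + 1))" unfolding s_def by simp
  also have "\<dots> \<le> a * 1" using a0 bp by (intro mult_left_mono) simp_all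
  finally show False using a0 by simp
qed

lemma positive_op_apply_eq_0:
  fixes S :: "'a::complex_inner \<Rightarrow> 'a"
  assumes S: "positive_op S" and w: "Re (cinner w (S w)) = 0"
  shows "S w = 0"
proof -
  have pos: "\<And>x. 0 \<le> Re (cinner x (S x))" using S unfolding positive_op_def by auto
  have sa: "\<And>x y. cinner (S x) y = cinner x (S y)"
    using positive_op_selfadj[OF S] unfolding selfadj_def by blast
  interpret S: bounded_linear S
    by (rule bounded_clinear_bounded_linear[OF positive_op_bounded_clinear[OF S]])
  \<comment> \<open>positivity of the form along the line \<open>w + t S w\<close> forces \<open>S w = 0\<close>\<close>
  have "0 \<le> 2 * t * (norm (S w))\<^sup>2 + t\<^sup>2 * Re (cinner (S w) (S (S w)))" for t :: real
  proof -
    have "cinner (w + t *\<^sub>R S w) (S (w + t *\<^sub>R S w)) = cinner w (S w)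
        + complex_of_real (t\<^sup>2) * cinner (S w) (S (S w))
        + 2 * complex_of_real t * cinner (S w) (S w)"
      by (simp add: S.add S.scaleR cinner_add_left cinner_add_right cinner_scaleR_left
          cinner_scaleR_right sa power2_eq_square distrib_left mult.assoc)
    then show ?thesis using pos[of "w + t *\<^sub>R S w"] w by (simp add: cinner_self)
  qed
  then have "(norm (S w))\<^sup>2 = 0"
    using pos[of "S w"] by (intro linear_coeff_eq_0_if_quadratic_nonneg) simp_all
  then show ?thesis by simp
qed

section \<open>The square-root power series\<close>

text \<open>The Taylor coefficients of \<open>1 - sqrt (1 - y) = (\<Sum>k. sqrt_coeff k * y ^ k)\<close>; the recursion
  is the coefficientwise form of \<open>s\<^sup>2 = 2 s - y\<close> for \<open>s = 1 - sqrt (1 - y)\<close>.\<close>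

function sqrt_coeff :: "nat \<Rightarrow> real" where
  "sqrt_coeff n = (if n = 0 then 0 else if n = 1 then 1/2
     else (\<Sum>i\<in>{1..<n}. sqrt_coeff i * sqrt_coeff (n - i)) / 2)"
  by auto
termination by (relation "Wellfounded.measure id") auto

declare sqrt_coeff.simps[simp del]

lemma sqrt_coeff_0: "sqrt_coeff 0 = 0"
  by (simp add: sqrt_coeff.simps)

lemma sqrt_coeff_1: "sqrt_coeff 1 = 1/2"
  by (simp add: sqrt_coeff.simps)

lemma sqrt_coeff_Suc_0 [simp]: "sqrt_coeff (Suc 0) = 1/2"
  using sqrt_coeff_1 by simp

lemma sqrt_coeff_rec:
  "n \<ge> 2 \<Longrightarrow> sqrt_coeff n = (\<Sum>i\<in>{1..<n}. sqrt_coeff i * sqrt_coeff (n - i)) / 2"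
  by (subst sqrt_coeff.simps) simp

lemma sqrt_coeff_nonneg: "0 \<le> sqrt_coeff n"
proof (induction n rule: less_induct)
  case (less n)
  show ?case
  proof (cases "n \<ge> 2")
    case True
    have "\<forall>i\<in>{1..<n}. 0 \<le> sqrt_coeff i * sqrt_coeff (n - i)" using less True by auto
    then have "0 \<le> (\<Sum>i\<in>{1..<n}. sqrt_coeff i * sqrt_coeff (n - i))" by (intro sum_nonneg) blast
    then show ?thesis using True by (simp add: sqrt_coeff_rec)
  next
    case False
    then have "n = 0 \<or> n = 1" by auto
    then show ?thesis by (auto simp: sqrt_coeff_0 sqrt_coeff_1)
  qed
qed

lemma sqrt_coeff_convolution:
  "(\<Sum>i\<le>n. sqrt_coeff i * sqrt_coeff (n - i)) = 2 * sqrt_coeff n - (if n = 1 then 1 else 0)"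
proof -
  consider "n = 0" | "n = 1" | "n \<ge> 2" by linarith
  then show ?thesis
  proof cases
    case 1 then show ?thesis by (simp add: sqrt_coeff_0)
  next
    case 2 then show ?thesis by (simp add: sqrt_coeff_0 sqrt_coeff_1)
  next
    case 3
    have "{..n} = insert 0 (insert n {1..<n})" using 3 by auto
    then have "(\<Sum>i\<le>n. sqrt_coeff i * sqrt_coeff (n - i)) =
        sqrt_coeff 0 * sqrt_coeff n + (sqrt_coeff n * sqrt_coeff 0
          + (\<Sum>i\<in>{1..<n}. sqrt_coeff i * sqrt_coeff (n - i)))"
      using 3 by simp
    then show ?thesis using 3 by (simp add: sqrt_coeff_0 sqrt_coeff_rec)
  qed
qed

lemma sum_convolution_le_square:
  fixes c :: "nat \<Rightarrow> real"
  assumes "\<And>n. 0 \<le> c n"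
  shows "(\<Sum>n\<in>{2..<N}. \<Sum>i\<in>{1..<n}. c i * c (n - i)) \<le> (\<Sum>i<N - 1. c i) * (\<Sum>i<N - 1. c i)"
proof -
  define h where "h = (\<lambda>(n::nat, i::nat). (i, n - i))"
  define D where "D = Sigma {2..<N} (\<lambda>n. {1..<n})"
  have "(\<Sum>n\<in>{2..<N}. \<Sum>i\<in>{1..<n}. c i * c (n - i)) = (\<Sum>(n, i)\<in>D. c i * c (n - i))"
    unfolding D_def by (rule sum.Sigma) auto
  also have "\<dots> = (\<Sum>p\<in>h ` D. c (fst p) * c (snd p))"
  proof (subst sum.reindex)
    show "inj_on h D" unfolding inj_on_def h_def D_def by auto
  qed (simp add: h_def case_prod_beta)
  also have "\<dots> \<le> (\<Sum>p\<in>{..<N - 1} \<times> {..<N - 1}. c (fst p) * c (snd p))"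
  proof (rule sum_mono2)
    show "h ` D \<subseteq> {..<N - 1} \<times> {..<N - 1}" unfolding h_def D_def by auto
  qed (simp_all add: assms)
  also have "\<dots> = (\<Sum>i<N - 1. c i) * (\<Sum>i<N - 1. c i)"
    by (simp add: sum_product sum.cartesian_product case_prod_beta)
  finally show ?thesis .
qed

lemma sum_sqrt_coeff_le_1: "(\<Sum>i<N. sqrt_coeff i) \<le> 1"
proof (induction N rule: less_induct)
  case (less N)
  show ?case
  proof (cases "N \<le> 2")
    case True
    then have "{..<N} \<subseteq> {0, 1}" by auto
    then have "(\<Sum>i<N. sqrt_coeff i) \<le> (\<Sum>i\<in>{0,1}. sqrt_coeff i)"
      by (intro sum_mono2) (simp_all add: sqrt_coeff_nonneg)
    then show ?thesis by (simp add: sqrt_coeff_0 sqrt_coeff_1)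
  next
    case False
    define s where "s = (\<Sum>i<N - 1. sqrt_coeff i)"
    have s1: "s \<le> 1" unfolding s_def using False by (intro less) auto
    have s0: "0 \<le> s" unfolding s_def by (simp add: sum_nonneg sqrt_coeff_nonneg)
    have split: "{..<N} = {0, 1} \<union> {2..<N}" using False by auto
    have "(\<Sum>i<N. sqrt_coeff i) = (\<Sum>i\<in>{0,1}. sqrt_coeff i) + (\<Sum>n\<in>{2..<N}. sqrt_coeff n)"
      unfolding split by (rule sum.union_disjoint) auto
    also have "(\<Sum>n\<in>{2..<N}. sqrt_coeff n)
        = (\<Sum>n\<in>{2..<N}. \<Sum>i\<in>{1..<n}. sqrt_coeff i * sqrt_coeff (n - i)) / 2"
      by (simp add: sqrt_coeff_rec sum_divide_distrib)
    also have "(\<Sum>n\<in>{2..<N}. \<Sum>i\<in>{1..<n}. sqrt_coeff i * sqrt_coeff (n - i)) \<le> s * s"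
      unfolding s_def by (rule sum_convolution_le_square[OF sqrt_coeff_nonneg])
    finally have "(\<Sum>i<N. sqrt_coeff i) \<le> (\<Sum>i\<in>{0,1}. sqrt_coeff i) + s * s / 2" by simp
    also have "s * s \<le> 1" using s0 s1 by (simp add: mult_le_one)
    finally show ?thesis by (simp add: sqrt_coeff_0 sqrt_coeff_1)
  qed
qed

lemma summable_sqrt_coeff: "summable sqrt_coeff"
  using sum_sqrt_coeff_le_1 sqrt_coeff_nonneg
  by (intro summableI_nonneg_bounded[of _ 1]) auto

lemma suminf_sqrt_coeff_le_1: "suminf sqrt_coeff \<le> 1"
  using summable_sqrt_coeff sum_sqrt_coeff_le_1 by (intro suminf_le_const) auto

lemma Zfun_sum_square_diff_triangle:
  fixes f :: "nat \<times> nat \<Rightarrow> real"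
  assumes f0: "\<And>p. 0 \<le> f p" and conv: "convergent (\<lambda>n. sum f ({..<n} \<times> {..<n}))"
  shows "Zfun (\<lambda>n. sum f ({..<n} \<times> {..<n} - {(i,j). i + j < n})) sequentially"
proof -
  let ?S1 = "\<lambda>n::nat. {..<n} \<times> {..<n}"
  let ?S2 = "\<lambda>n::nat. {(i,j). i + j < n}"
  have S1_mono: "\<And>m n. m \<le> n \<Longrightarrow> ?S1 m \<subseteq> ?S1 n" by auto
  have S1_le_S2: "\<And>n. ?S1 (n div 2) \<subseteq> ?S2 n" by auto
  have finite_S1: "\<And>n. finite (?S1 n)" by simp
  have norm_sum_f: "\<And>A. norm (sum f A) = sum f A"
    unfolding real_norm_def using f0 by (simp only: abs_of_nonneg sum_nonneg)
  have Cauchy: "Cauchy (\<lambda>n. sum f (?S1 n))" using conv by (rule convergent_Cauchy)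
  show ?thesis
  proof (rule ZfunI, simp only: eventually_sequentially norm_sum_f)
    fix r :: real
    assume r: "0 < r"
    from CauchyD [OF Cauchy r] obtain N
      where "\<forall>m\<ge>N. \<forall>n\<ge>N. norm (sum f (?S1 m) - sum f (?S1 n)) < r" ..
    then have "\<And>m n. N \<le> n \<Longrightarrow> n \<le> m \<Longrightarrow> norm (sum f (?S1 m - ?S1 n)) < r"
      by (simp only: sum_diff finite_S1 S1_mono)
    then have N: "\<And>m n. N \<le> n \<Longrightarrow> n \<le> m \<Longrightarrow> sum f (?S1 m - ?S1 n) < r"
      by (simp only: norm_sum_f)
    show "\<exists>N. \<forall>n\<ge>N. sum f (?S1 n - ?S2 n) < r"
    proof (intro exI allI impI)
      fix n
      assume "2 * N \<le> n"
      then have n: "N \<le> n div 2" by simp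
      have "sum f (?S1 n - ?S2 n) \<le> sum f (?S1 n - ?S1 (n div 2))"
        by (intro sum_mono2 finite_Diff finite_S1 f0 Diff_mono subset_refl S1_le_S2)
      also have "\<dots> < r"
        using n div_le_dividend by (rule N)
      finally show "sum f (?S1 n - ?S2 n) < r" .
    qed
  qed
qed

lemma tendsto_triangle_sum_if_tendsto_square_sum:
  fixes g :: "nat \<times> nat \<Rightarrow> 'a::real_normed_vector" and f :: "nat \<times> nat \<Rightarrow> real"
  assumes f0: "\<And>p. 0 \<le> f p" and gf: "\<And>p. norm (g p) \<le> f p"
    and conv: "convergent (\<lambda>n. sum f ({..<n} \<times> {..<n}))"
    and lim: "(\<lambda>n. sum g ({..<n} \<times> {..<n})) \<longlonglongrightarrow> L"
  shows "(\<lambda>n. sum g {(i,j). i + j < n}) \<longlonglongrightarrow> L"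
proof -
  let ?S1 = "\<lambda>n::nat. {..<n} \<times> {..<n}"
  let ?S2 = "\<lambda>n::nat. {(i,j). i + j < n}"
  have S2_le_S1: "\<And>n. ?S2 n \<subseteq> ?S1 n" by auto
  have finite_S1: "\<And>n. finite (?S1 n)" by simp
  have "Zfun (\<lambda>n. sum g (?S1 n - ?S2 n)) sequentially"
  proof (rule Zfun_le[rule_format, OF Zfun_sum_square_diff_triangle[OF f0 conv]])
    have "norm (sum f A) = sum f A" for A
      unfolding real_norm_def using f0 by (simp only: abs_of_nonneg sum_nonneg)
    then show "norm (sum g (?S1 n - ?S2 n)) \<le> norm (sum f (?S1 n - ?S2 n))" for n
      by (simp only:) (rule order_trans[OF norm_sum sum_mono[OF gf]])
  qed
  then have "(\<lambda>n. sum g (?S1 n) - sum g (?S2 n)) \<longlonglongrightarrow> 0"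
    unfolding tendsto_Zfun_iff diff_0_right
    by (simp only: sum_diff finite_S1 S2_le_S1)
  with lim show ?thesis
    by (rule Lim_transform2)
qed

definition contraction :: "('a::complex_normed_vector \<Rightarrow> 'a) \<Rightarrow> bool" where
  "contraction Y \<longleftrightarrow> bounded_clinear Y \<and> (\<forall>v. norm (Y v) \<le> norm v)"

text \<open>The operator \<open>1 - sqrt (1 - Y)\<close>, applied to \<open>v\<close>.\<close>

definition sqrt_series :: "('a::real_normed_vector \<Rightarrow> 'a) \<Rightarrow> 'a \<Rightarrow> 'a" where
  "sqrt_series Y v = (\<Sum>k. sqrt_coeff k *\<^sub>R (Y ^^ k) v)"

lemma norm_funpow_contraction_le: "contraction Y \<Longrightarrow> norm ((Y ^^ k) v) \<le> norm v"
proof (induction k)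
  case (Suc k)
  have "norm (Y ((Y ^^ k) v)) \<le> norm ((Y ^^ k) v)"
    using Suc.prems unfolding contraction_def by blast
  then show ?case using Suc by simp
qed simp

lemma sqrt_series_intertwine:
  fixes Y :: "'a::real_normed_vector \<Rightarrow> 'a" and Y' :: "'b::real_normed_vector \<Rightarrow> 'b"
  assumes summable: "summable (\<lambda>k. sqrt_coeff k *\<^sub>R (Y ^^ k) v)"
    and K: "bounded_linear K" and comm: "\<And>v. K (Y v) = Y' (K v)"
  shows "K (sqrt_series Y v) = sqrt_series Y' (K v)"
proof -
  interpret K: bounded_linear K by (rule K)
  have "K ((Y ^^ k) v) = (Y' ^^ k) (K v)" for k
    by (induction k) (simp_all add: comm)
  then show ?thesis
    unfolding sqrt_series_def K.suminf[OF summable] by (simp add: K.scaleR)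
qed

context
  fixes Y :: "'a::chilbert_space \<Rightarrow> 'a"
  assumes Y: "contraction Y"
begin

lemma bounded_linear_funpow_contraction: "bounded_linear (Y ^^ k)"
  using Y unfolding contraction_def
  by (intro bounded_clinear_bounded_linear bounded_clinear_funpow) simp

lemma norm_sqrt_series_term_le: "norm (sqrt_coeff k *\<^sub>R (Y ^^ k) v) \<le> sqrt_coeff k * norm v"
  using norm_funpow_contraction_le[OF Y, of k v] sqrt_coeff_nonneg[of k]
  by (simp add: mult_left_mono)

lemma summable_norm_sqrt_series_terms: "summable (\<lambda>k. norm (sqrt_coeff k *\<^sub>R (Y ^^ k) v))"
proof (rule summable_comparison_test')
  show "summable (\<lambda>k. sqrt_coeff k * norm v)" by (rule summable_mult2[OF summable_sqrt_coeff])
  show "norm (norm (sqrt_coeff k *\<^sub>R (Y ^^ k) v)) \<le> sqrt_coeff k * norm v" for k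
    using norm_sqrt_series_term_le by simp
qed

lemma summable_sqrt_series_terms: "summable (\<lambda>k. sqrt_coeff k *\<^sub>R (Y ^^ k) v)"
  by (rule summable_norm_cancel) (rule summable_norm_sqrt_series_terms)

lemma norm_sqrt_series_le: "norm (sqrt_series Y v) \<le> norm v"
proof -
  have "norm (sqrt_series Y v) \<le> (\<Sum>k. norm (sqrt_coeff k *\<^sub>R (Y ^^ k) v))"
    unfolding sqrt_series_def by (rule summable_norm) (rule summable_norm_sqrt_series_terms)
  also have "\<dots> \<le> (\<Sum>k. sqrt_coeff k * norm v)"
    by (intro suminf_le norm_sqrt_series_term_le summable_norm_sqrt_series_terms
        summable_mult2[OF summable_sqrt_coeff])
  also have "\<dots> = suminf sqrt_coeff * norm v"
    by (rule suminf_mult2[OF summable_sqrt_coeff, symmetric])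
  also have "\<dots> \<le> 1 * norm v" by (rule mult_right_mono[OF suminf_sqrt_coeff_le_1]) simp
  finally show ?thesis by simp
qed

lemma sqrt_series_add: "sqrt_series Y (v + w) = sqrt_series Y v + sqrt_series Y w"
proof -
  interpret Yk: bounded_linear "Y ^^ k" for k by (rule bounded_linear_funpow_contraction)
  show ?thesis
    unfolding sqrt_series_def
    by (simp add: Yk.add scaleR_add_right
        suminf_add[OF summable_sqrt_series_terms summable_sqrt_series_terms])
qed

lemma sqrt_series_diff: "sqrt_series Y (v - w) = sqrt_series Y v - sqrt_series Y w"
  using sqrt_series_add[of "v - w" w] by simp

lemma sqrt_series_scaleC: "sqrt_series Y (a *\<^sub>C v) = a *\<^sub>C sqrt_series Y v"
  using Y unfolding contraction_def
  by (intro sqrt_series_intertwine[symmetric] summable_sqrt_series_terms bounded_linear_scaleC)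
    (simp add: bounded_clinear_scaleC)

lemma sqrt_series_scaleR: "sqrt_series Y (a *\<^sub>R v) = a *\<^sub>R sqrt_series Y v"
  by (simp add: scaleR_scaleC sqrt_series_scaleC)

lemma sqrt_series_tendsto_square_sums:
  "(\<lambda>n. \<Sum>(i, j)\<in>{..<n} \<times> {..<n}. (sqrt_coeff i * sqrt_coeff j) *\<^sub>R (Y ^^ (i + j)) v)
     \<longlonglongrightarrow> sqrt_series Y (sqrt_series Y v)"
proof -
  interpret Yk: bounded_linear "Y ^^ k" for k by (rule bounded_linear_funpow_contraction)
  define Q where "Q n z = (\<Sum>i<n. sqrt_coeff i *\<^sub>R (Y ^^ i) z)" for n z
  define u where "u n = Q n v" for n
  have square: "(\<Sum>(i, j)\<in>{..<n} \<times> {..<n}. (sqrt_coeff i * sqrt_coeff j) *\<^sub>R (Y ^^ (i + j)) v)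
      = Q n (u n)" for n
    unfolding Q_def u_def
    by (simp add: Yk.sum Yk.scaleR scaleR_sum_right funpow_add sum.cartesian_product)
  have u: "u \<longlonglongrightarrow> sqrt_series Y v"
    unfolding u_def Q_def sqrt_series_def by (rule summable_LIMSEQ[OF summable_sqrt_series_terms])
  have "(\<lambda>n. Q n (u n) - Q n (sqrt_series Y v)) \<longlonglongrightarrow> 0"
  proof (rule Lim_null_comparison)
    show "(\<lambda>n. norm (u n - sqrt_series Y v)) \<longlonglongrightarrow> 0"
      using u by (simp add: tendsto_norm_zero_iff LIM_zero_iff)
    show "\<forall>\<^sub>F n in sequentially.
        norm (Q n (u n) - Q n (sqrt_series Y v)) \<le> norm (u n - sqrt_series Y v)"
    proof (rule always_eventually, rule allI)
      fix n
      have "Q n (u n) - Q n (sqrt_series Y v) = Q n (u n - sqrt_series Y v)"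
        unfolding Q_def by (simp add: Yk.diff sum_subtractf scaleR_diff_right)
      then have "norm (Q n (u n) - Q n (sqrt_series Y v)) = norm (Q n (u n - sqrt_series Y v))"
        by simp
      also have "\<dots> \<le> (\<Sum>i<n. norm (sqrt_coeff i *\<^sub>R (Y ^^ i) (u n - sqrt_series Y v)))"
        unfolding Q_def by (rule norm_sum)
      also have "\<dots> \<le> (\<Sum>i<n. sqrt_coeff i) * norm (u n - sqrt_series Y v)"
        unfolding sum_distrib_right by (intro sum_mono norm_sqrt_series_term_le)
      also have "\<dots> \<le> norm (u n - sqrt_series Y v)"
        using mult_right_mono[OF sum_sqrt_coeff_le_1 norm_ge_zero] by simp
      finally show "norm (Q n (u n) - Q n (sqrt_series Y v)) \<le> norm (u n - sqrt_series Y v)" .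
    qed
  qed
  moreover have "(\<lambda>n. Q n (sqrt_series Y v)) \<longlonglongrightarrow> sqrt_series Y (sqrt_series Y v)"
    unfolding Q_def sqrt_series_def[of Y "sqrt_series Y v"]
    by (rule summable_LIMSEQ[OF summable_sqrt_series_terms])
  ultimately have "(\<lambda>n. (Q n (u n) - Q n (sqrt_series Y v)) + Q n (sqrt_series Y v))
      \<longlonglongrightarrow> 0 + sqrt_series Y (sqrt_series Y v)"
    by (rule tendsto_add)
  then show ?thesis unfolding square by simp
qed

lemma sqrt_series_tendsto_triangle_sums:
  "(\<lambda>n. \<Sum>(i, j)\<in>{(i, j). i + j < n}. (sqrt_coeff i * sqrt_coeff j) *\<^sub>R (Y ^^ (i + j)) v)
     \<longlonglongrightarrow> sqrt_series Y (sqrt_series Y v)"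
proof (rule tendsto_triangle_sum_if_tendsto_square_sum[OF _ _ _ sqrt_series_tendsto_square_sums])
  define f where "f = (\<lambda>(i::nat, j::nat). sqrt_coeff i * sqrt_coeff j * norm v)"
  show "0 \<le> f p" for p unfolding f_def using sqrt_coeff_nonneg by (auto simp: case_prod_beta)
  show "norm ((\<lambda>(i, j). (sqrt_coeff i * sqrt_coeff j) *\<^sub>R (Y ^^ (i + j)) v) p) \<le> f p" for p
    unfolding f_def using norm_funpow_contraction_le[OF Y] sqrt_coeff_nonneg
    by (auto simp: case_prod_beta mult_left_mono)
  have "sum f ({..<n} \<times> {..<n}) = (\<Sum>i<n. sqrt_coeff i) * (\<Sum>j<n. sqrt_coeff j) * norm v" for n
  proof -
    have "sum f ({..<n} \<times> {..<n}) = (\<Sum>i<n. \<Sum>j<n. sqrt_coeff i * sqrt_coeff j) * norm v"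
      unfolding f_def sum.cartesian_product[symmetric] by (simp add: sum_distrib_right)
    then show ?thesis by (simp only: sum_product)
  qed
  moreover have "(\<lambda>n. (\<Sum>i<n. sqrt_coeff i) * (\<Sum>j<n. sqrt_coeff j) * norm v)
      \<longlonglongrightarrow> suminf sqrt_coeff * suminf sqrt_coeff * norm v"
    by (intro tendsto_intros summable_LIMSEQ[OF summable_sqrt_coeff])
  ultimately show "convergent (\<lambda>n. sum f ({..<n} \<times> {..<n}))"
    unfolding convergent_def by auto
qed

lemma sqrt_series_square: "sqrt_series Y (sqrt_series Y v) = 2 *\<^sub>R sqrt_series Y v - Y v"
proof -
  define w where "w n = (Y ^^ n) v" for n
  define b where "b k = 2 * sqrt_coeff k - (if k = 1 then 1 else 0)" for k
  have triangle: "(\<Sum>(i, j)\<in>{(i, j). i + j < n}. (sqrt_coeff i * sqrt_coeff j) *\<^sub>R w (i + j))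
      = (\<Sum>k<n. b k *\<^sub>R w k)" for n
  proof -
    have "(\<Sum>(i, j)\<in>{(i, j). i + j < n}. (sqrt_coeff i * sqrt_coeff j) *\<^sub>R w (i + j))
        = (\<Sum>k<n. \<Sum>i\<le>k. (sqrt_coeff i * sqrt_coeff (k - i)) *\<^sub>R w (i + (k - i)))"
      by (rule sum.triangle_reindex)
    also have "\<dots> = (\<Sum>k<n. (\<Sum>i\<le>k. sqrt_coeff i * sqrt_coeff (k - i)) *\<^sub>R w k)"
      by (simp add: scaleR_sum_left)
    finally show ?thesis unfolding b_def sqrt_coeff_convolution .
  qed
  have "(\<lambda>k. b k *\<^sub>R w k) sums sqrt_series Y (sqrt_series Y v)"
    using sqrt_series_tendsto_triangle_sums[of v] unfolding sums_def triangle[symmetric]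
    unfolding w_def .
  moreover have "(\<lambda>k. b k *\<^sub>R w k) sums (2 *\<^sub>R sqrt_series Y v - Y v)"
  proof -
    have "(\<lambda>k. 2 *\<^sub>R (sqrt_coeff k *\<^sub>R w k) - (if k = 1 then w k else 0))
        sums (2 *\<^sub>R sqrt_series Y v - w 1)"
      unfolding sqrt_series_def w_def
      by (intro sums_diff sums_scaleR_right summable_sums summable_sqrt_series_terms sums_single)
    moreover have "(\<lambda>k. 2 *\<^sub>R (sqrt_coeff k *\<^sub>R w k) - (if k = 1 then w k else 0))
        = (\<lambda>k. b k *\<^sub>R w k)"
      unfolding b_def by (rule ext) (simp add: scaleR_diff_left)
    ultimately show ?thesis unfolding w_def by simp
  qed
  ultimately show ?thesis by (rule sums_unique2)
qed

end

section \<open>Square roots of positive operators\<close>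

text \<open>\<open>M\<close> bounds \<open>X\<close> in the sense \<open>X\<^sup>2 \<le> M X\<close>, which makes \<open>I - X / M\<close> a contraction.\<close>

definition positive_op_bound :: "('a::chilbert_space \<Rightarrow> 'a) \<Rightarrow> real \<Rightarrow> bool" where
  "positive_op_bound X M \<longleftrightarrow>
     positive_op X \<and> 0 < M \<and> (\<forall>v. (norm (X v))\<^sup>2 \<le> M * Re (cinner v (X v)))"

definition sqrt_arg :: "('a::chilbert_space \<Rightarrow> 'a) \<Rightarrow> real \<Rightarrow> 'a \<Rightarrow> 'a" where
  "sqrt_arg X M = (\<lambda>v. v - (1 / M) *\<^sub>R X v)"

text \<open>\<open>sqrt X = sqrt M * sqrt (I - Y)\<close> for \<open>Y = sqrt_arg X M\<close>.\<close>

definition series_sqrt :: "('a::chilbert_space \<Rightarrow> 'a) \<Rightarrow> real \<Rightarrow> 'a \<Rightarrow> 'a" where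
  "series_sqrt X M = (\<lambda>v. sqrt M *\<^sub>R (v - sqrt_series (sqrt_arg X M) v))"

definition op_sqrt :: "('a::chilbert_space \<Rightarrow> 'a) \<Rightarrow> 'a \<Rightarrow> 'a" where
  "op_sqrt X = (THE S. positive_op S \<and> S \<circ> S = X)"

lemma positive_op_bound_mono: "positive_op_bound X M \<Longrightarrow> M \<le> M' \<Longrightarrow> positive_op_bound X M'"
  unfolding positive_op_bound_def positive_op_def
  by (meson less_le_trans mult_right_mono order_trans)

context
  fixes X :: "'a::chilbert_space \<Rightarrow> 'a" and M :: real
  assumes X: "positive_op_bound X M"
begin

lemma positive_op_boundD:
  "bounded_clinear X" "selfadj X" "\<And>v. 0 \<le> Re (cinner v (X v))" "0 < M"
  "\<And>v. (norm (X v))\<^sup>2 \<le> M * Re (cinner v (X v))"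
  using X positive_op_selfadj unfolding positive_op_bound_def positive_op_def by auto

lemma selfadj_sqrt_arg: "selfadj (sqrt_arg X M)"
  using positive_op_boundD(2) unfolding selfadj_def sqrt_arg_def
  by (simp add: cinner_diff_left cinner_diff_right cinner_scaleR_left cinner_scaleR_right)

lemma contraction_sqrt_arg: "contraction (sqrt_arg X M)"
  unfolding contraction_def
proof (intro conjI allI)
  show "bounded_clinear (sqrt_arg X M)"
    unfolding sqrt_arg_def
    by (intro bounded_clinear_diff bounded_clinear_ident bounded_clinear_scaleR positive_op_boundD)
  fix v
  define r where "r = Re (cinner v (X v))"
  have M: "0 < M" by (rule positive_op_boundD)
  have "(norm (sqrt_arg X M v))\<^sup>2 = (norm v)\<^sup>2 + (norm (X v))\<^sup>2 / M\<^sup>2 - 2 * (r / M)"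
    unfolding sqrt_arg_def r_def norm_diff_power2
    by (simp add: cinner_scaleR_right power_divide)
  moreover have "(norm (X v))\<^sup>2 / M\<^sup>2 \<le> r / M"
    using positive_op_boundD(5)[of v] M unfolding r_def
    by (simp add: divide_le_eq power2_eq_square mult.commute mult.left_commute)
  moreover have "0 \<le> r / M"
    using positive_op_boundD(3)[of v] M unfolding r_def by simp
  ultimately have "(norm (sqrt_arg X M v))\<^sup>2 \<le> (norm v)\<^sup>2" by linarith
  then show "norm (sqrt_arg X M v) \<le> norm v" by (rule power2_le_imp_le) simp
qed

lemma cinner_sqrt_series_sqrt_arg:
  "cinner (sqrt_series (sqrt_arg X M) v) w = cinner v (sqrt_series (sqrt_arg X M) w)"
proof -
  let ?Y = "sqrt_arg X M"
  interpret left: bounded_linear "\<lambda>z. cinner z w"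
    by (rule bounded_bilinear.bounded_linear_left[OF bounded_bilinear_cinner])
  interpret right: bounded_linear "\<lambda>z. cinner v z"
    by (rule bounded_bilinear.bounded_linear_right[OF bounded_bilinear_cinner])
  have "cinner ((?Y ^^ k) v) w = cinner v ((?Y ^^ k) w)" for k
    using selfadj_funpow[OF selfadj_sqrt_arg, of k] unfolding selfadj_def by blast
  then show ?thesis
    unfolding sqrt_series_def left.suminf[OF summable_sqrt_series_terms[OF contraction_sqrt_arg]]
      right.suminf[OF summable_sqrt_series_terms[OF contraction_sqrt_arg]]
    by (simp add: cinner_scaleR_left cinner_scaleR_right)
qed

lemma bounded_clinear_series_sqrt: "bounded_clinear (series_sqrt X M)"
proof (rule bounded_clinear_intro[where K = "sqrt M * 2"])
  note Y = contraction_sqrt_arg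
  show "series_sqrt X M (x + y) = series_sqrt X M x + series_sqrt X M y" for x y
    unfolding series_sqrt_def by (simp add: sqrt_series_add[OF Y] algebra_simps)
  show "series_sqrt X M (a *\<^sub>C x) = a *\<^sub>C series_sqrt X M x" for a x
    unfolding series_sqrt_def
    by (simp add: sqrt_series_scaleC[OF Y] scaleC_diff_right scaleR_scaleC scaleC_scaleC
        mult.commute)
  show "norm (series_sqrt X M x) \<le> norm x * (sqrt M * 2)" for x
  proof -
    have "norm (x - sqrt_series (sqrt_arg X M) x) \<le> norm x + norm (sqrt_series (sqrt_arg X M) x)"
      by (rule norm_triangle_ineq4)
    also have "\<dots> \<le> norm x * 2" using norm_sqrt_series_le[OF Y, of x] by simp
    finally show ?thesis unfolding series_sqrt_def using positive_op_boundD(4)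
      by (simp add: mult_left_mono mult.commute mult.left_commute)
  qed
qed

lemma positive_op_series_sqrt: "positive_op (series_sqrt X M)"
  unfolding positive_op_def
proof (intro conjI allI bounded_clinear_series_sqrt)
  let ?s = "sqrt_series (sqrt_arg X M)"
  fix v
  have "selfadj (series_sqrt X M)"
    unfolding selfadj_def series_sqrt_def
    by (simp add: cinner_scaleR_left cinner_scaleR_right cinner_diff_left cinner_diff_right
        cinner_sqrt_series_sqrt_arg)
  then show "Im (cinner v (series_sqrt X M v)) = 0" by (rule Im_cinner_selfadj)
  have "Re (cinner v (?s v)) \<le> norm v * norm (?s v)" by (rule Re_cinner_le)
  also have "\<dots> \<le> (norm v)\<^sup>2"
    using mult_left_mono[OF norm_sqrt_series_le[OF contraction_sqrt_arg]]
    by (simp add: power2_eq_square)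
  finally have "0 \<le> sqrt M * ((norm v)\<^sup>2 - Re (cinner v (?s v)))"
    using positive_op_boundD(4) by simp
  then show "0 \<le> Re (cinner v (series_sqrt X M v))"
    unfolding series_sqrt_def by (simp add: cinner_scaleR_right cinner_diff_right Re_cinner_self)
qed

lemma series_sqrt_square: "series_sqrt X M (series_sqrt X M v) = X v"
proof -
  let ?s = "sqrt_series (sqrt_arg X M)"
  note Y = contraction_sqrt_arg
  have M: "0 < M" by (rule positive_op_boundD)
  have "series_sqrt X M (series_sqrt X M v)
      = sqrt M *\<^sub>R (sqrt M *\<^sub>R (v - ?s v) - ?s (sqrt M *\<^sub>R (v - ?s v)))"
    unfolding series_sqrt_def by simp
  also have "?s (sqrt M *\<^sub>R (v - ?s v)) = sqrt M *\<^sub>R (?s v - ?s (?s v))"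
    by (simp add: sqrt_series_scaleR[OF Y] sqrt_series_diff[OF Y])
  also have "?s (?s v) = 2 *\<^sub>R ?s v - sqrt_arg X M v" by (rule sqrt_series_square[OF Y])
  finally have "series_sqrt X M (series_sqrt X M v) = (sqrt M * sqrt M) *\<^sub>R (v - sqrt_arg X M v)"
    by (simp add: algebra_simps scaleR_2)
  also have "sqrt M * sqrt M = M" using M by simp
  also have "v - sqrt_arg X M v = (1 / M) *\<^sub>R X v" unfolding sqrt_arg_def by simp
  finally show ?thesis using M by simp
qed

end

lemma series_sqrt_intertwine:
  fixes X X' K :: "'a::chilbert_space \<Rightarrow> 'a"
  assumes X: "positive_op_bound X M" and X': "positive_op_bound X' M" and K: "bounded_clinear K"
    and comm: "\<And>v. K (X v) = X' (K v)"
  shows "K (series_sqrt X M v) = series_sqrt X' M (K v)"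
proof -
  interpret K: bounded_linear K by (rule bounded_clinear_bounded_linear[OF K])
  have "K (sqrt_arg X M v) = sqrt_arg X' M (K v)" for v
    unfolding sqrt_arg_def by (simp add: K.diff K.scaleR comm)
  then have "K (sqrt_series (sqrt_arg X M) v) = sqrt_series (sqrt_arg X' M) (K v)"
    by (intro sqrt_series_intertwine summable_sqrt_series_terms contraction_sqrt_arg[OF X]
        K.bounded_linear)
  then show ?thesis unfolding series_sqrt_def by (simp add: K.diff K.scaleR)
qed

lemma positive_sqrt_unique:
  fixes X S :: "'a::chilbert_space \<Rightarrow> 'a"
  assumes X: "positive_op_bound X M" and S: "positive_op S" and SS: "S \<circ> S = X"
  shows "S = series_sqrt X M"
proof -
  define R where "R = series_sqrt X M"
  have R: "positive_op R" unfolding R_def by (rule positive_op_series_sqrt[OF X])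
  have RR: "R (R v) = X v" for v unfolding R_def by (rule series_sqrt_square[OF X])
  have SSv: "S (S v) = X v" for v using SS by (metis comp_apply)
  \<comment> \<open>\<open>S\<close> commutes with \<open>X = S\<^sup>2\<close>, hence with every power series in \<open>X\<close>\<close>
  have SR: "S (R v) = R (S v)" for v
    unfolding R_def by (rule series_sqrt_intertwine[OF X X positive_op_bounded_clinear[OF S]])
      (metis SSv)
  interpret S: bounded_linear S
    by (rule bounded_clinear_bounded_linear[OF positive_op_bounded_clinear[OF S]])
  interpret R: bounded_linear R
    by (rule bounded_clinear_bounded_linear[OF positive_op_bounded_clinear[OF R]])
  define D where "D v = S v - R v" for v
  have saD: "cinner (D x) y = cinner x (D y)" for x y
    using positive_op_selfadj[OF S] positive_op_selfadj[OF R]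
    unfolding D_def selfadj_def by (simp add: cinner_diff_left cinner_diff_right)
  have DD: "D (D x) = 0" for x
  proof -
    define w where "w = D x"
    have "D (S w + R w) = 0" unfolding D_def by (simp add: S.add R.add SR SSv RR)
    then have "cinner w (S w + R w) = 0" using saD[of x "S w + R w"] unfolding w_def by simp
    then have "Re (cinner w (S w)) + Re (cinner w (R w)) = 0"
      by (metis cinner_add_right plus_complex.sel(1) zero_complex.sel(1))
    moreover have "0 \<le> Re (cinner w (S w))" "0 \<le> Re (cinner w (R w))"
      using S R unfolding positive_op_def by auto
    ultimately have "S w = 0" "R w = 0"
      using positive_op_apply_eq_0[OF S, of w] positive_op_apply_eq_0[OF R, of w] by auto
    then show ?thesis unfolding w_def by (simp add: D_def[of "D x"])
  qed
  have "D x = 0" for x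
    using saD[of x "D x"] DD[of x] by (simp only: cinner_zero_right cinner_eq_zero_iff)
  then show ?thesis unfolding R_def[symmetric] by (intro ext) (simp add: D_def)
qed

lemma op_sqrt_eq_series_sqrt: "positive_op_bound X M \<Longrightarrow> op_sqrt X = series_sqrt X M"
  unfolding op_sqrt_def
  by (rule the_equality)
    (auto simp: positive_op_series_sqrt series_sqrt_square positive_sqrt_unique o_def)

lemma positive_op_op_sqrt: "positive_op_bound X M \<Longrightarrow> positive_op (op_sqrt X)"
  by (simp add: op_sqrt_eq_series_sqrt positive_op_series_sqrt)

lemma op_sqrt_square: "positive_op_bound X M \<Longrightarrow> op_sqrt X (op_sqrt X v) = X v"
  by (simp add: op_sqrt_eq_series_sqrt series_sqrt_square)

lemma op_sqrt_intertwine: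
  fixes X X' K :: "'a::chilbert_space \<Rightarrow> 'a"
  assumes X: "positive_op_bound X M" and X': "positive_op_bound X' M'" and K: "bounded_clinear K"
    and comm: "\<And>v. K (X v) = X' (K v)"
  shows "K (op_sqrt X v) = op_sqrt X' (K v)"
proof -
  have X_max: "positive_op_bound X (max M M')" and X'_max: "positive_op_bound X' (max M M')"
    using positive_op_bound_mono[OF X] positive_op_bound_mono[OF X'] by simp_all
  show ?thesis
    unfolding op_sqrt_eq_series_sqrt[OF X_max] op_sqrt_eq_series_sqrt[OF X'_max]
    by (rule series_sqrt_intertwine[OF X_max X'_max K]) (rule comm)
qed

lemma positive_op_bound_adj_comp:
  fixes B :: "'a::chilbert_space \<Rightarrow> 'a"
  assumes B: "bounded_clinear B"
  shows "\<exists>M. positive_op_bound (adj B \<circ> B) M"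
proof -
  obtain K where K: "\<And>x. norm (adj B x) \<le> norm x * K" "K > 0"
    using bounded_linear.pos_bounded[OF
        bounded_clinear_bounded_linear[OF bounded_clinear_adj[OF B]]]
    by blast
  have form: "cinner v ((adj B \<circ> B) v) = complex_of_real ((norm (B v))\<^sup>2)" for v
    by (simp add: cinner_adj_right[OF B] cinner_self)
  have "(norm ((adj B \<circ> B) v))\<^sup>2 \<le> K\<^sup>2 * Re (cinner v ((adj B \<circ> B) v))" for v
  proof -
    have "(norm ((adj B \<circ> B) v))\<^sup>2 \<le> (norm (B v) * K)\<^sup>2"
      using K(1)[of "B v"] by (intro power_mono) simp_all
    then show ?thesis unfolding form by (simp add: power_mult_distrib mult.commute)
  qed
  moreover have "bounded_clinear (adj B \<circ> B)"
    by (rule bounded_clinear_comp[OF bounded_clinear_adj[OF B] B])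
  ultimately have "positive_op_bound (adj B \<circ> B) (K\<^sup>2)"
    unfolding positive_op_bound_def positive_op_def form using K(2) by simp
  then show ?thesis by blast
qed

section \<open>Modulus, positive part and spectral subspaces\<close>

lemma op_abs_eq_op_sqrt: "op_abs T = op_sqrt (adj T \<circ> T)"
  unfolding op_abs_def op_sqrt_def ..

context
  fixes T :: "'a::chilbert_space \<Rightarrow> 'a"
  assumes T: "bounded_clinear T"
begin

lemma positive_op_op_abs: "positive_op (op_abs T)"
  using positive_op_bound_adj_comp[OF T] positive_op_op_sqrt unfolding op_abs_eq_op_sqrt by blast

lemma op_abs_square: "op_abs T (op_abs T v) = adj T (T v)"
  using positive_op_bound_adj_comp[OF T] op_sqrt_square unfolding op_abs_eq_op_sqrt by fastforce

lemma op_abs_apply_eq_0: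
  assumes "T x = 0"
  shows "op_abs T x = 0"
proof -
  interpret adjT: bounded_linear "adj T"
    by (rule bounded_clinear_bounded_linear[OF bounded_clinear_adj[OF T]])
  have "cinner (op_abs T x) (op_abs T x) = cinner x (op_abs T (op_abs T x))"
    using positive_op_selfadj[OF positive_op_op_abs] unfolding selfadj_def by blast
  also have "\<dots> = 0" using assms by (simp add: op_abs_square)
  finally show ?thesis by (simp only: cinner_eq_zero_iff)
qed

end

lemma op_abs_intertwine:
  fixes K B B' :: "'a::chilbert_space \<Rightarrow> 'a"
  assumes K: "bounded_clinear K" and B: "bounded_clinear B" and B': "bounded_clinear B'"
    and comm: "\<And>v. K (adj B (B v)) = adj B' (B' (K v))"
  shows "K (op_abs B v) = op_abs B' (K v)"
proof -
  obtain M M' where "positive_op_bound (adj B \<circ> B) M" "positive_op_bound (adj B' \<circ> B') M'"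
    using positive_op_bound_adj_comp[OF B] positive_op_bound_adj_comp[OF B'] by blast
  then show ?thesis
    unfolding op_abs_eq_op_sqrt by (rule op_sqrt_intertwine[OF _ _ K]) (simp add: comm)
qed

lemma op_abs_adj_intertwine:
  fixes T :: "'a::chilbert_space \<Rightarrow> 'a"
  assumes T: "bounded_clinear T"
  shows "T (op_abs T v) = op_abs (adj T) (T v)"
  using op_abs_intertwine[OF T T bounded_clinear_adj[OF T]] by (simp add: adj_adj[OF T])

lemma op_abs_selfadj_intertwine:
  fixes K B B' :: "'a::chilbert_space \<Rightarrow> 'a"
  assumes K: "bounded_clinear K" and B: "bounded_clinear B" "selfadj B"
    and B': "bounded_clinear B'" "selfadj B'" and comm: "\<And>v. K (B v) = B' (K v)"
  shows "K (op_abs B v) = op_abs B' (K v)"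
  using op_abs_intertwine[OF K B(1) B'(1)] by (simp add: adj_selfadj B(2) B'(2) comm)

lemma bounded_clinear_pos_part:
  fixes B :: "'a::chilbert_space \<Rightarrow> 'a"
  assumes "bounded_clinear B"
  shows "bounded_clinear (pos_part B)"
  unfolding pos_part_def
  using assms positive_op_bounded_clinear[OF positive_op_op_abs[OF assms]]
  by (intro bounded_clinear_scaleR bounded_clinear_add)

lemma pos_part_intertwine:
  fixes K B B' :: "'a::chilbert_space \<Rightarrow> 'a"
  assumes K: "bounded_clinear K" and B: "bounded_clinear B" "selfadj B"
    and B': "bounded_clinear B'" "selfadj B'" and comm: "\<And>v. K (B v) = B' (K v)"
  shows "K (pos_part B v) = pos_part B' (K v)"
proof -
  interpret K: bounded_linear K by (rule bounded_clinear_bounded_linear[OF K])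
  have "K (op_abs B v) = op_abs B' (K v)"
    by (rule op_abs_selfadj_intertwine[OF K B B']) (rule comm)
  then show ?thesis
    unfolding pos_part_def by (simp add: K.add K.scaleR comm)
qed

lemma pos_part_apply_eq_0_if_eigenvector:
  fixes B :: "'a::chilbert_space \<Rightarrow> 'a"
  assumes B: "bounded_clinear B" "selfadj B" and c: "c > 0" and Bx: "B x = - (c *\<^sub>R x)"
  shows "pos_part B x = 0"
proof -
  let ?P = "op_abs B"
  have P: "positive_op ?P" by (rule positive_op_op_abs[OF B(1)])
  interpret P: bounded_linear ?P
    by (rule bounded_clinear_bounded_linear[OF positive_op_bounded_clinear[OF P]])
  interpret B: bounded_linear B by (rule bounded_clinear_bounded_linear[OF B(1)])
  have PPx: "?P (?P x) = (c * c) *\<^sub>R x"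
    using op_abs_square[OF B(1), of x] by (simp add: adj_selfadj[OF B(2)] Bx B.neg B.scaleR)
  \<comment> \<open>\<open>z\<close> satisfies \<open>P z = - c z\<close>, which positivity of \<open>P\<close> forbids unless \<open>z = 0\<close>\<close>
  define z where "z = ?P x - c *\<^sub>R x"
  have "?P z = - (c *\<^sub>R z)"
    unfolding z_def by (simp add: P.diff P.scaleR PPx algebra_simps)
  then have "Re (cinner z (?P z)) = - (c * (norm z)\<^sup>2)"
    by (simp add: cinner_minus_right cinner_scaleR_right cinner_self)
  moreover have "0 \<le> Re (cinner z (?P z))" using P unfolding positive_op_def by blast
  ultimately have "z = 0" using c by (simp add: mult_le_0_iff)
  then show ?thesis unfolding pos_part_def z_def using Bx by simp
qed

definition spectral_subspace_le :: "('a::complex_inner \<Rightarrow> 'a) \<Rightarrow> real \<Rightarrow> 'a set" where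
  "spectral_subspace_le A c = {x. pos_part (\<lambda>y. A y - c *\<^sub>R y) x = 0}"

lemma spectral_proj_le_eq: "spectral_proj_le A c = orth_proj (spectral_subspace_le A c)"
  unfolding spectral_proj_le_def spectral_subspace_le_def ..

lemma bounded_clinear_diff_scaleR:
  "bounded_clinear A \<Longrightarrow> bounded_clinear (\<lambda>y. A y - c *\<^sub>R y)"
  by (intro bounded_clinear_diff bounded_clinear_scaleR bounded_clinear_ident)

lemma closed_csubspace_spectral_subspace_le:
  fixes A :: "'a::chilbert_space \<Rightarrow> 'a"
  assumes "bounded_clinear A"
  shows "closed (spectral_subspace_le A c)" "csubspace (spectral_subspace_le A c)"
  unfolding spectral_subspace_le_def
  using closed_csubspace_kernel[OF
      bounded_clinear_pos_part[OF bounded_clinear_diff_scaleR[OF assms]]]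
  by auto

lemma spectral_subspace_le_intertwine:
  fixes K A A' :: "'a::chilbert_space \<Rightarrow> 'a"
  assumes K: "bounded_clinear K" and A: "bounded_clinear A" "selfadj A"
    and A': "bounded_clinear A'" "selfadj A'" and comm: "\<And>v. K (A v) = A' (K v)"
  shows "K ` spectral_subspace_le A c \<subseteq> spectral_subspace_le A' c"
proof -
  interpret K: bounded_linear K by (rule bounded_clinear_bounded_linear[OF K])
  have "pos_part (\<lambda>y. A' y - c *\<^sub>R y) (K x) = K (pos_part (\<lambda>y. A y - c *\<^sub>R y) x)" for x
    using A A' by (intro pos_part_intertwine[OF K, symmetric] bounded_clinear_diff_scaleR
        selfadj_diff_scaleR) (simp_all add: K.diff K.scaleR comm)
  then show ?thesis unfolding spectral_subspace_le_def by auto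
qed

context
  fixes T :: "'a::chilbert_space \<Rightarrow> 'a"
  assumes T: "bounded_clinear T"
begin

lemma closed_csubspace_spectral_subspace_le_op_abs:
  "closed (spectral_subspace_le (op_abs T) c)" "csubspace (spectral_subspace_le (op_abs T) c)"
  using closed_csubspace_spectral_subspace_le
    positive_op_bounded_clinear[OF positive_op_op_abs[OF T]]
  by blast+

lemma image_spectral_subspace_le_op_abs:
  "T ` spectral_subspace_le (op_abs T) c \<subseteq> spectral_subspace_le (op_abs (adj T)) c"
  using positive_op_op_abs[OF T] positive_op_op_abs[OF bounded_clinear_adj[OF T]]
  by (intro spectral_subspace_le_intertwine[OF T] op_abs_adj_intertwine[OF T]
      positive_op_bounded_clinear positive_op_selfadj)

lemma kernel_in_spectral_subspace_le_op_abs: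
  assumes "c > 0" and "T x = 0"
  shows "x \<in> spectral_subspace_le (op_abs T) c"
proof -
  have A: "bounded_clinear (op_abs T)" "selfadj (op_abs T)"
    using positive_op_op_abs[OF T]
    by (simp_all add: positive_op_bounded_clinear positive_op_selfadj)
  have "op_abs T x - c *\<^sub>R x = - (c *\<^sub>R x)" by (simp add: op_abs_apply_eq_0[OF T assms(2)])
  then show ?thesis
    unfolding spectral_subspace_le_def
    using A by (auto intro!: pos_part_apply_eq_0_if_eigenvector assms(1)
        bounded_clinear_diff_scaleR selfadj_diff_scaleR)
qed

end

section \<open>Images under \<open>T\<close> and \<open>T\<^sup>*\<close>\<close>

lemma orthogonal_complement_image_iff:
  fixes T :: "'a::chilbert_space \<Rightarrow> 'a"
  assumes T: "bounded_clinear T"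
  shows "r \<in> orthogonal_complement (T ` S) \<longleftrightarrow> adj T r \<in> orthogonal_complement S"
  unfolding orthogonal_complement_def by (simp add: cinner_adj_right[OF T])

lemma image_orthogonal_complement_subset:
  fixes T :: "'a::chilbert_space \<Rightarrow> 'a"
  assumes T: "bounded_clinear T" and "adj T ` A \<subseteq> B"
  shows "T ` orthogonal_complement B \<subseteq> orthogonal_complement A"
  using assms unfolding orthogonal_complement_def by (auto simp: cinner_adj_left[OF T, symmetric])

context
  fixes T :: "'a::chilbert_space \<Rightarrow> 'a"
  assumes T: "bounded_clinear T"
begin

lemma closure_image_orthogonal_complement:
  fixes N N' :: "'a set"
  assumes N: "closed N" "csubspace N" and N': "closed N'" "csubspace N'"
    and TN: "T ` N \<subseteq> N'" and adjTN': "adj T ` N' \<subseteq> N"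
    and kernel: "\<And>r. adj T r = 0 \<Longrightarrow> r \<in> N'"
  shows "closure (T ` orthogonal_complement N) = orthogonal_complement N'"
proof
  have sub: "T ` orthogonal_complement N \<subseteq> orthogonal_complement N'"
    by (rule image_orthogonal_complement_subset[OF T adjTN'])
  then show "closure (T ` orthogonal_complement N) \<subseteq> orthogonal_complement N'"
    using closed_orthogonal_complement by (rule closure_minimal)
  show "orthogonal_complement N' \<subseteq> closure (T ` orthogonal_complement N)"
  proof
    fix y assume y: "y \<in> orthogonal_complement N'"
    define C where "C = closure (T ` orthogonal_complement N)"
    have C: "closed C" "csubspace C" unfolding C_def
      by (simp_all add: csubspace_closure csubspace_image[OF T csubspace_orthogonal_complement])
    define r where "r = y - orth_proj C y"
    have "C \<subseteq> orthogonal_complement N'"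
      unfolding C_def using sub closed_orthogonal_complement by (rule closure_minimal)
    then have "orth_proj C y \<in> orthogonal_complement N'" using orth_proj_in[OF C] by blast
    then have rN': "r \<in> orthogonal_complement N'"
      unfolding r_def by (rule csubspace_diff[OF csubspace_orthogonal_complement y])
    have "r \<in> orthogonal_complement (T ` orthogonal_complement N)"
      unfolding r_def using orth_proj_residual[OF C] unfolding C_def orthogonal_complement_closure .
    then have "adj T r \<in> N"
      unfolding orthogonal_complement_image_iff[OF T]
        orthogonal_complement_orthogonal_complement[OF N] .
    moreover have "adj T ` orthogonal_complement N' \<subseteq> orthogonal_complement N"
      by (rule image_orthogonal_complement_subset[OF bounded_clinear_adj[OF T]])
        (simp add: adj_adj[OF T] TN)
    then have "adj T r \<in> orthogonal_complement N" using rN' by blast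
    ultimately have "r \<in> N'" by (intro kernel in_orthogonal_complement_self)
    then have "r = 0" using rN' by (rule in_orthogonal_complement_self)
    then show "y \<in> closure (T ` orthogonal_complement N)"
      using orth_proj_in[OF C, of y] unfolding r_def C_def by simp
  qed
qed

lemma closure_range_spectral_complement:
  assumes c: "c > 0"
  shows "closure (range (\<lambda>y. T (y - spectral_proj_le (op_abs T) c y)))
    = orthogonal_complement (spectral_subspace_le (op_abs (adj T)) c)"
proof -
  have adjT: "bounded_clinear (adj T)" by (rule bounded_clinear_adj[OF T])
  define N where "N = spectral_subspace_le (op_abs T) c"
  define N' where "N' = spectral_subspace_le (op_abs (adj T)) c"
  have N: "closed N" "csubspace N" and N': "closed N'" "csubspace N'"
    unfolding N_def N'_def
    by (simp_all add: closed_csubspace_spectral_subspace_le_op_abs T adjT)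
  have "y - spectral_proj_le (op_abs T) c y = orth_proj (orthogonal_complement N) y" for y
    unfolding spectral_proj_le_eq N_def[symmetric]
    by (simp add: orth_proj_orthogonal_complement[OF N])
  then have "range (\<lambda>y. T (y - spectral_proj_le (op_abs T) c y))
      = T ` range (orth_proj (orthogonal_complement N))"
    by (simp only: range_composition)
  also have "\<dots> = T ` orthogonal_complement N"
    by (simp only: range_orth_proj[OF closed_orthogonal_complement csubspace_orthogonal_complement])
  also have "closure \<dots> = orthogonal_complement N'"
  proof (rule closure_image_orthogonal_complement[OF N N'])
    show "T ` N \<subseteq> N'" unfolding N_def N'_def by (rule image_spectral_subspace_le_op_abs[OF T])
    show "adj T ` N' \<subseteq> N"
      using image_spectral_subspace_le_op_abs[OF adjT] unfolding N_def N'_def adj_adj[OF T] .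
    show "r \<in> N'" if "adj T r = 0" for r
      unfolding N'_def by (rule kernel_in_spectral_subspace_le_op_abs[OF adjT c that])
  qed
  finally show ?thesis unfolding N'_def .
qed

lemma norm_adj_le_if_orthogonal_range:
  fixes E :: "'a \<Rightarrow> 'a"
  assumes TE: "\<And>z. norm (T (E z)) \<le> a * norm z" and a: "0 \<le> a"
    and b: "b \<in> orthogonal_complement (range (\<lambda>y. T (y - E y)))"
  shows "norm (adj T b) \<le> a * norm b"
proof -
  define z where "z = adj T b"
  \<comment> \<open>\<open>z - E z\<close> is orthogonal to \<open>z = T\<^sup>* b\<close> because \<open>b\<close> is orthogonal to \<open>T (z - E z)\<close>\<close>
  have "\<forall>m\<in>range (\<lambda>y. T (y - E y)). cinner m b = 0"
    using b unfolding orthogonal_complement_def by simp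
  then have "cinner (T (z - E z)) b = 0" by (rule bspec[OF _ rangeI])
  then have "cinner (z - E z) z = 0"
    unfolding z_def by (simp only: cinner_adj_right[OF T])
  then have "cinner z z = cinner (E z) z"
    by (simp add: cinner_diff_left)
  also have "\<dots> = cinner (T (E z)) b"
    unfolding z_def by (rule cinner_adj_right[OF T])
  finally have "(norm z)\<^sup>2 = Re (cinner (T (E z)) b)"
    by (simp only: Re_cinner_self[symmetric])
  also have "\<dots> \<le> norm (T (E z)) * norm b" by (rule Re_cinner_le)
  also have "\<dots> \<le> a * norm b * norm z"
    using mult_right_mono[OF TE[of z] norm_ge_zero[of b]] by (simp only: mult_ac)
  finally have "(norm z)\<^sup>2 \<le> a * norm b * norm z" .
  then show ?thesis
    unfolding z_def using square_le_mult_imp_le[of "a * norm b" "norm (adj T b)"] a by simp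
qed

lemma lower_bound_adj_on_closure_image:
  assumes c: "0 \<le> c" and below: "\<And>v. v \<in> V \<Longrightarrow> c * norm v \<le> norm (T v)"
    and \<beta>: "\<beta> \<in> closure (T ` V)"
  shows "c * norm \<beta> \<le> norm (adj T \<beta>)"
proof -
  have closed: "closed {\<beta>. c * norm \<beta> \<le> norm (adj T \<beta>)}"
  proof (rule closed_Collect_le)
    show "continuous_on UNIV (\<lambda>\<beta>::'a. c * norm \<beta>)" by (intro continuous_intros)
    have "continuous_on UNIV (adj T)"
      by (rule linear_continuous_on[OF
            bounded_clinear_bounded_linear[OF bounded_clinear_adj[OF T]]])
    then show "continuous_on UNIV (\<lambda>\<beta>. norm (adj T \<beta>))" by (intro continuous_intros)
  qed
  have "T ` V \<subseteq> {\<beta>. c * norm \<beta> \<le> norm (adj T \<beta>)}"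
  proof safe
    fix v assume v: "v \<in> V"
    have "(norm (T v))\<^sup>2 = Re (cinner (adj T (T v)) v)"
      by (simp add: cinner_adj_left[OF T] flip: Re_cinner_self)
    also have "\<dots> \<le> norm (adj T (T v)) * norm v" by (rule Re_cinner_le)
    finally have "c * (norm (T v))\<^sup>2 \<le> c * (norm (adj T (T v)) * norm v)"
      by (rule mult_left_mono[OF _ c])
    also have "\<dots> = norm (adj T (T v)) * (c * norm v)" by (simp only: mult_ac)
    also have "\<dots> \<le> norm (adj T (T v)) * norm (T v)"
      by (rule mult_left_mono[OF below[OF v] norm_ge_zero])
    finally have "(c * norm (T v)) * norm (T v) \<le> norm (adj T (T v)) * norm (T v)"
      by (simp only: power2_eq_square mult.assoc)
    then show "c * norm (T v) \<le> norm (adj T (T v))"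
      by (cases "T v = 0") (simp_all add: mult_le_cancel_right)
  qed
  then have "closure (T ` V) \<subseteq> {\<beta>. c * norm \<beta> \<le> norm (adj T \<beta>)}"
    using closed by (rule closure_minimal)
  then show ?thesis using \<beta> by blast
qed

end

context
  fixes S :: "'a::chilbert_space \<Rightarrow> 'a"
  assumes S: "bounded_clinear S"
begin

lemma closed_csubspace_closure_range:
  "closed (closure (range S))" "csubspace (closure (range S))"
  by (simp_all add: csubspace_closure csubspace_image[OF S csubspace_UNIV])

lemma range_range_proj: "range (range_proj S) = closure (range S)"
  unfolding range_proj_def by (rule range_orth_proj[OF closed_csubspace_closure_range])

lemma diff_range_proj: "x - range_proj S x = orth_proj (orthogonal_complement (range S)) x"
  using orth_proj_orthogonal_complement[OF closed_csubspace_closure_range, of x]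
  unfolding range_proj_def orthogonal_complement_closure by simp

lemma range_proj_fixpoint: "x \<in> closure (range S) \<Longrightarrow> range_proj S x = x"
  unfolding range_proj_def by (rule orth_proj_fixpoint[OF closed_csubspace_closure_range])

end

lemma diff_range_proj_spectral_proj_le:
  fixes T :: "'a::chilbert_space \<Rightarrow> 'a"
  assumes T: "bounded_clinear T" and c: "c > 0"
  shows "(\<lambda>x. x - range_proj (\<lambda>y. T (y - spectral_proj_le (op_abs T) c y)) x)
    = spectral_proj_le (op_abs (adj T)) c"
proof
  fix x
  have "range_proj (\<lambda>y. T (y - spectral_proj_le (op_abs T) c y))
      = orth_proj (orthogonal_complement (spectral_subspace_le (op_abs (adj T)) c))"
    unfolding range_proj_def closure_range_spectral_complement[OF T c] ..
  then show "x - range_proj (\<lambda>y. T (y - spectral_proj_le (op_abs T) c y)) x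
      = spectral_proj_le (op_abs (adj T)) c x"
    unfolding spectral_proj_le_eq
    using diff_orth_proj_orthogonal_complement[OF closed_csubspace_spectral_subspace_le_op_abs]
      bounded_clinear_adj[OF T] by simp
qed

lemma onorm_adj_comp_orth_proj_le:
  fixes T E :: "'a::chilbert_space \<Rightarrow> 'a"
  assumes T: "bounded_clinear T" and E: "bounded_linear E"
    and TE: "onorm (T \<circ> E) \<le> a" and a: "0 \<le> a"
  shows "onorm (adj T \<circ> orth_proj (orthogonal_complement (range (\<lambda>y. T (y - E y))))) \<le> a"
proof (rule onorm_bound[OF a])
  let ?M = "orthogonal_complement (range (\<lambda>y. T (y - E y)))"
  have "bounded_linear (T \<circ> E)"
    unfolding o_def by (rule bounded_linear_compose[OF bounded_clinear_bounded_linear[OF T] E])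
  then have "norm (T (E z)) \<le> a * norm z" for z
    using onorm[of "T \<circ> E" z] mult_right_mono[OF TE norm_ge_zero[of z]] by simp
  then have "norm (adj T (orth_proj ?M x)) \<le> a * norm (orth_proj ?M x)" for x
    using orth_proj_in[OF closed_orthogonal_complement csubspace_orthogonal_complement]
    by (intro norm_adj_le_if_orthogonal_range[OF T _ a])
  also have "a * norm (orth_proj ?M x) \<le> a * norm x" for x
    using norm_orth_proj_le[OF closed_orthogonal_complement csubspace_orthogonal_complement] a
    by (intro mult_left_mono)
  finally show "norm ((adj T \<circ> orth_proj ?M) x) \<le> a * norm x" for x by simp
qed

lemma lower_bound_adj_on_range_proj:
  fixes T E :: "'a::chilbert_space \<Rightarrow> 'a"
  assumes T: "bounded_clinear T" and E: "bounded_clinear E" and idem: "E \<circ> E = E" and c: "0 \<le> c"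
    and below: "\<forall>\<xi>\<in>range (\<lambda>x. x - E x). c * norm \<xi> \<le> norm (T (\<xi> - E \<xi>))"
    and \<beta>: "\<beta> \<in> range (range_proj (\<lambda>y. T (y - E y)))"
  shows "c * norm \<beta> \<le> norm (adj T \<beta>)"
proof (rule lower_bound_adj_on_closure_image[OF T c])
  interpret E: bounded_linear E by (rule bounded_clinear_bounded_linear[OF E])
  show "c * norm v \<le> norm (T v)" if v_range: "v \<in> range (\<lambda>x. x - E x)" for v
  proof -
    obtain x where v: "v = x - E x" using v_range by blast
    have "c * norm v \<le> norm (T (v - E v))" using below v_range by blast
    moreover have "v - E v = v" unfolding v using idem by (simp add: E.diff fun_eq_iff)
    ultimately show ?thesis by simp
  qed
  have "bounded_clinear (\<lambda>y. T (y - E y))"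
    using bounded_clinear_comp[OF T bounded_clinear_diff[OF bounded_clinear_ident E]]
    by (simp add: o_def)
  then show "\<beta> \<in> closure (T ` range (\<lambda>x. x - E x))"
    using \<beta> range_range_proj[of "\<lambda>y. T (y - E y)"] by (simp add: image_image)
qed

theorem proposition3p2:
  fixes T E :: "'a::chilbert_space \<Rightarrow> 'a" and a c :: real
  assumes T: "bounded_clinear T"
    and a: "a > 0" and c: "c > 0"
    and E: "bounded_clinear E" and idem: "E \<circ> E = E"
    and TE: "onorm (T \<circ> E) \<le> a"
    and below: "\<forall>\<xi>\<in>range (\<lambda>x. x - E x). c * norm \<xi> \<le> norm (T (\<xi> - E \<xi>))"
  defines "F \<equiv> (\<lambda>x. x - range_proj (\<lambda>y. T (y - E y)) x)"
  shows "onorm (adj T \<circ> F) \<le> a \<and>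
         (\<forall>\<beta>\<in>range (\<lambda>x. x - F x). c * norm \<beta> \<le> norm (adj T (\<beta> - F \<beta>))) \<and>
         (E = spectral_proj_le (op_abs T) c \<longrightarrow>
           F = spectral_proj_le (op_abs (adj T)) c \<and>
           (\<lambda>x. x - E x) = range_proj (\<lambda>y. adj T (y - F y)))"
proof (intro conjI ballI impI)
  let ?S = "\<lambda>y. T (y - E y)"
  have S: "bounded_clinear ?S"
    using bounded_clinear_comp[OF T bounded_clinear_diff[OF bounded_clinear_ident E]]
    by (simp add: o_def)
  have "F = orth_proj (orthogonal_complement (range ?S))"
    unfolding F_def by (rule ext) (rule diff_range_proj[OF S])
  then show "onorm (adj T \<circ> F) \<le> a"
    using onorm_adj_comp_orth_proj_le[OF T bounded_clinear_bounded_linear[OF E] TE] a by simp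
  fix \<beta> assume "\<beta> \<in> range (\<lambda>x. x - F x)"
  then have \<beta>: "\<beta> \<in> range (range_proj ?S)" unfolding F_def by simp
  then have "\<beta> - F \<beta> = \<beta>"
    unfolding F_def using range_proj_fixpoint[OF S] range_range_proj[OF S] by simp
  then show "c * norm \<beta> \<le> norm (adj T (\<beta> - F \<beta>))"
    using lower_bound_adj_on_range_proj[OF T E idem _ below \<beta>] c by simp
next
  assume E_spec: "E = spectral_proj_le (op_abs T) c"
  show F_spec: "F = spectral_proj_le (op_abs (adj T)) c"
    unfolding F_def E_spec by (rule diff_range_proj_spectral_proj_le[OF T c])
  have "(\<lambda>x. x - range_proj (\<lambda>y. adj T (y - F y)) x) = E"
    using diff_range_proj_spectral_proj_le[OF bounded_clinear_adj[OF T] c]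
    unfolding F_spec E_spec adj_adj[OF T] .
  then show "(\<lambda>x. x - E x) = range_proj (\<lambda>y. adj T (y - F y))"
    by (auto simp flip: diff_eq_eq)
qed

end
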